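(* Let $X(t)=(X_1(t),\ldots,X_n(t))^T$, $t\in[0,\tau]$, be a zero-mean $\mathbb{R}^n$-valued process with continuous samples and continuous correlation functions, and let $X_d(t)$, $d=(d_1,\ldots,d_n)$, be its finite dimensional (FD) models as defined in the context. If, for every $i=1,\ldots,n$, the second-order partial derivatives of the correlation function $c_{ii}(s,t)=E[X_i(s)X_i(t)]$ exist and are continuous on $[0,\tau]^2$, then $$\sup_{t\in[0,\tau]}\|X_d(t)-X(t)\|\ \overset{p}{\to}\ 0\quad\text{as }\min_{1\le i\le n}d_i\to\infty,$$ where $\overset{p}{\to}$ denotes convergence in probability and $\|\cdot\|$ is the $L_\infty$ norm on $\mathbb{R}^n$.
   Context: Fix $n\ge1$ and $0<\tau<\infty$. $X(t)=(X_1(t),\ldots,X_n(t))^T$, $t\in[0,\tau]$, is an $\mathbb{R}^n$-valued process on a probability space $(\Omega,\mathcal{F},P)$ with continuous samples, $E[X_i(t)]=0$, finite variances, and continuous correlation functions $c_{ij}(s,t)=E[X_i(s)X_j(t)]$ on $[0,\tau]^2$. The $L_\infty$ norm on $\mathbb{R}^n$ is $\|x\|=\max_{1\le i\le n}|x_i|$. For each $i$, $\{\lambda_{i,k}\}_{k\ge1}$ (in non-increasing order) and $\{\varphi_{i,k}\}_{k\ge1}$ denote the eigenvalues and the corresponding orthonormal (in $L_2[0,\tau]$), continuous eigenfunctions of $c_{ii}$, i.e. $\int_0^\tau c_{ii}(s,t)\varphi_{i,k}(t)\,dt=\lambda_{i,k}\varphi_{i,k}(s)$, $s\in[0,\tau]$.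 For integers $d_i\ge1$ and $d=(d_1,\ldots,d_n)$, the FD model $X_d(t)=(X_{1,d_1}(t),\ldots,X_{n,d_n}(t))^T$ of $X(t)$ is defined on the same probability space by $$X_{i,d_i}(t)=\sum_{k=1}^{d_i}Z_{i,k}\,\varphi_{i,k}(t),\qquad Z_{i,k}(\omega)=\int_0^\tau X_i(t,\omega)\varphi_{i,k}(t)\,dt,\quad \omega\in\Omega,$$ so that $\varphi_{i,1},\ldots,\varphi_{i,d_i}$ are the eigenfunctions corresponding to the $d_i$ largest eigenvalues of $c_{ii}$. *)

theory Defs
  imports "HOL-Probability.Probability"
begin

text \<open>
  Processes on \<open>[0,\<tau>]\<close> are total functions of time; only their values at times in
  \<open>{0..\<tau>}\<close> are constrained. Components are indexed by a finite type \<open>'n\<close>.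
\<close>

definition correlation ::
    "'w measure \<Rightarrow> (real \<Rightarrow> 'w \<Rightarrow> real ^ 'n) \<Rightarrow> 'n \<Rightarrow> 'n \<Rightarrow> real \<Rightarrow> real \<Rightarrow> real" where
  "correlation M X i j s t = (LINT \<omega>|M. X s \<omega> $ i * X t \<omega> $ j)"

text \<open>Square integrability makes the means and correlations below genuine integrals.\<close>

definition continuous_zero_mean_process ::
    "'w measure \<Rightarrow> real \<Rightarrow> (real \<Rightarrow> 'w \<Rightarrow> real ^ 'n) \<Rightarrow> bool" where
  "continuous_zero_mean_process M \<tau> X \<longleftrightarrow>
     (\<forall>t\<in>{0..\<tau>}. X t \<in> borel_measurable M) \<and>
     (\<forall>\<omega>\<in>space M. continuous_on {0..\<tau>} (\<lambda>t. X t \<omega>)) \<and>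
     (\<forall>i. \<forall>t\<in>{0..\<tau>}. integrable M (\<lambda>\<omega>. (X t \<omega> $ i)\<^sup>2)) \<and>
     (\<forall>i. \<forall>t\<in>{0..\<tau>}. (LINT \<omega>|M. X t \<omega> $ i) = 0) \<and>
     (\<forall>i j. continuous_on ({0..\<tau>} \<times> {0..\<tau>}) (\<lambda>(s, t). correlation M X i j s t))"

definition eigenfunction ::
    "real \<Rightarrow> (real \<Rightarrow> real \<Rightarrow> real) \<Rightarrow> real \<Rightarrow> (real \<Rightarrow> real) \<Rightarrow> bool" where
  "eigenfunction \<tau> c \<mu> f \<longleftrightarrow>
     continuous_on {0..\<tau>} f \<and> (\<exists>t\<in>{0..\<tau>}. f t \<noteq> 0) \<and>
     (\<forall>s\<in>{0..\<tau>}. (LBINT t:{0..\<tau>}. c s t * f t) = \<mu> * f s)"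

text \<open>
  The pairs \<open>(lam k, phi k)\<close>, \<open>k \<ge> 1\<close>, list the eigenvalues in non-increasing order with an
  orthonormal system of continuous eigenfunctions. The last conjunct says that the list is
  exhaustive, with multiplicities: each eigenspace of a nonzero eigenvalue is spanned by the
  listed eigenfunctions. It is not imposed for the eigenvalue 0: that eigenspace may be
  infinite-dimensional, and if infinitely many eigenvalues are positive then 0 cannot occur in a
  non-increasing list. If the kernel has finite rank, the list is continued with eigenvalue 0.
\<close>

definition eigensystem ::
    "real \<Rightarrow> (real \<Rightarrow> real \<Rightarrow> real) \<Rightarrow> (nat \<Rightarrow> real) \<Rightarrow> (nat \<Rightarrow> real \<Rightarrow> real) \<Rightarrow> bool" where
  "eigensystem \<tau> c lam phi \<longleftrightarrow>
     (\<forall>k\<ge>1. eigenfunction \<tau> c (lam k) (phi k)) \<and>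
     (\<forall>k\<ge>1. lam (Suc k) \<le> lam k) \<and>
     (\<forall>j\<ge>1. \<forall>k\<ge>1. (LBINT t:{0..\<tau>}. phi j t * phi k t) = (if j = k then 1 else 0)) \<and>
     (\<forall>\<mu> f. \<mu> \<noteq> 0 \<longrightarrow> eigenfunction \<tau> c \<mu> f \<longrightarrow>
        (\<exists>K a. finite K \<and> K \<subseteq> {k. 1 \<le> k \<and> lam k = \<mu>} \<and>
           (\<forall>s\<in>{0..\<tau>}. f s = (\<Sum>k\<in>K. a k * phi k s))))"

definition fd_coeff ::
    "real \<Rightarrow> (real \<Rightarrow> 'w \<Rightarrow> real ^ 'n) \<Rightarrow> ('n \<Rightarrow> nat \<Rightarrow> real \<Rightarrow> real) \<Rightarrow> 'n \<Rightarrow> nat \<Rightarrow> 'w \<Rightarrow> real" where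
  "fd_coeff \<tau> X phi i k \<omega> = (LBINT t:{0..\<tau>}. X t \<omega> $ i * phi i k t)"

definition fd_model ::
    "real \<Rightarrow> (real \<Rightarrow> 'w \<Rightarrow> real ^ 'n) \<Rightarrow> ('n \<Rightarrow> nat \<Rightarrow> real \<Rightarrow> real) \<Rightarrow> ('n \<Rightarrow> nat) \<Rightarrow>
     real \<Rightarrow> 'w \<Rightarrow> real ^ 'n" where
  "fd_model \<tau> X phi d t \<omega> = (\<chi> i. \<Sum>k=1..d i. fd_coeff \<tau> X phi i k \<omega> * phi i k t)"

text \<open>Partial derivatives on the closed square, one-sided on its boundary.\<close>

definition has_partial_fst ::
    "real \<Rightarrow> (real \<Rightarrow> real \<Rightarrow> real) \<Rightarrow> (real \<Rightarrow> real \<Rightarrow> real) \<Rightarrow> bool" where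
  "has_partial_fst \<tau> g g' \<longleftrightarrow>
     (\<forall>s\<in>{0..\<tau>}. \<forall>t\<in>{0..\<tau>}. ((\<lambda>u. g u t) has_real_derivative g' s t) (at s within {0..\<tau>}))"

definition has_partial_snd ::
    "real \<Rightarrow> (real \<Rightarrow> real \<Rightarrow> real) \<Rightarrow> (real \<Rightarrow> real \<Rightarrow> real) \<Rightarrow> bool" where
  "has_partial_snd \<tau> g g' \<longleftrightarrow>
     (\<forall>s\<in>{0..\<tau>}. \<forall>t\<in>{0..\<tau>}. ((\<lambda>u. g s u) has_real_derivative g' s t) (at t within {0..\<tau>}))"

definition continuous_second_partials :: "real \<Rightarrow> (real \<Rightarrow> real \<Rightarrow> real) \<Rightarrow> bool" where
  "continuous_second_partials \<tau> g \<longleftrightarrow>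
     (\<exists>g1 g2 g11 g12 g21 g22.
        has_partial_fst \<tau> g g1 \<and> has_partial_snd \<tau> g g2 \<and>
        has_partial_fst \<tau> g1 g11 \<and> has_partial_snd \<tau> g1 g12 \<and>
        has_partial_fst \<tau> g2 g21 \<and> has_partial_snd \<tau> g2 g22 \<and>
        (\<forall>h\<in>{g11, g12, g21, g22}. continuous_on ({0..\<tau>} \<times> {0..\<tau>}) (\<lambda>(s, t). h s t)))"

text \<open>
  Convergence in probability along a filter. Measurability is part of the notion, since
  \<^const>\<open>measure\<close> is 0 on non-measurable sets.
\<close>

definition tendsto_in_probability ::
    "'w measure \<Rightarrow> ('d \<Rightarrow> 'w \<Rightarrow> real) \<Rightarrow> ('w \<Rightarrow> real) \<Rightarrow> 'd filter \<Rightarrow> bool" where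
  "tendsto_in_probability M Y Z F \<longleftrightarrow>
     (\<forall>d. Y d \<in> borel_measurable M) \<and> Z \<in> borel_measurable M \<and>
     (\<forall>\<epsilon>>0. ((\<lambda>d. measure M {\<omega> \<in> space M. \<bar>Y d \<omega> - Z \<omega>\<bar> > \<epsilon>}) \<longlongrightarrow> 0) F)"

end

theory Submission
  imports Defs "HOL-Complex_Analysis.Great_Picard"
begin

text \<open>
  Subtracting the first \<open>m\<close> Karhunen--Loeve terms from a component leaves a residual with
  \<open>E (R\<^sub>m t)\<^sup>2 = c t t - (\<Sum>k\<le>m. \<lambda>\<^sub>k (\<phi>\<^sub>k t)\<^sup>2)\<close>, which tends to 0 by Mercer's theorem on the diagonal, and with
  \<open>E (R\<^sub>m t - R\<^sub>m s)\<^sup>2 \<le> E (X t - X s)\<^sup>2 \<le> K (t - s)\<^sup>2\<close> uniformly in \<open>m\<close>. The last bound is the only use of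
  the differentiability of \<open>c\<close>; the eigenfunctions need not be differentiated. Quadratic increment
  bounds suffice for chaining over dyadic partitions, so pointwise convergence in mean square
  becomes uniform convergence in probability.
\<close>

subsection \<open>Eigenvalues of continuous symmetric kernels\<close>

text \<open>Subtracting the first \<open>m\<close> terms is an orthogonal projection in the L_2
  space of \<open>M\<close>: the coefficients are uncorrelated and the \<open>k\<close>-th has
  variance \<open>lam k\<close>. Second moments of the residual and of its increments therefore only
  drop, which is why one \<open>K\<close> serves all \<open>m\<close>. This \<open>K\<close> bounds
  a mixed second derivative, since E (X t - X s)^2 is a second difference of \<open>c\<close> over a
  square. Its exponent 2 exceeds the dimension 1 of the time set, so a union bound over
  \<open>2 ^ l\<close> intervals still decays. The obstacle is Mercer's theorem. The given list is
  only known to exhaust the eigenspaces of nonzero eigenvalues, so its completeness must come from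
  an eigenvalue of the kernel left over, and that kernel must first be shown continuous. The bound
  with \<open>K\<close> achieves this too: it makes the partial sums equi-Lipschitz.\<close>

lemma abs_mult_le_sum_squares: "\<bar>x * y\<bar> \<le> x\<^sup>2 + y\<^sup>2" for x y :: real
proof -
  have "0 \<le> (\<bar>x\<bar> - \<bar>y\<bar>)\<^sup>2" "0 \<le> x\<^sup>2" "0 \<le> y\<^sup>2" by auto
  then show ?thesis
    unfolding power2_diff abs_mult power2_abs by linarith
qed

lemma continuous_on_compact_abs_bound:
  fixes f :: "'a::topological_space \<Rightarrow> real"
  assumes "compact S" "continuous_on S f"
  obtains B where "\<And>x. x \<in> S \<Longrightarrow> \<bar>f x\<bar> \<le> B"
proof -
  have "bounded (f ` S)"
    by (intro compact_imp_bounded compact_continuous_image assms)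
  then obtain B where "\<forall>z\<in>f ` S. norm z \<le> B"
    unfolding bounded_iff by blast
  then have "\<bar>f x\<bar> \<le> B" if "x \<in> S" for x
    using that by simp
  then show ?thesis by (rule that)
qed

text \<open>Written with the Henstock--Kurzweil integral, whose rules for parameter integrals,
  exchange of integrals and uniform limits apply directly to continuous integrands.
  \<open>set_lebesgue_integral_continuous_eq\<close> translates from the Lebesgue integrals in
  \<open>eigensystem\<close>.\<close>

definition l2_inner :: "real \<Rightarrow> real \<Rightarrow> (real \<Rightarrow> real) \<Rightarrow> (real \<Rightarrow> real) \<Rightarrow> real" where
  "l2_inner a b f g = integral {a..b} (\<lambda>t. f t * g t)"

lemma l2_inner_commute: "l2_inner a b f g = l2_inner a b g f"
  by (simp add: l2_inner_def mult.commute)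

lemma l2_inner_scale_left: "l2_inner a b (\<lambda>t. c * f t) g = c * l2_inner a b f g"
  by (simp add: l2_inner_def mult.assoc)

lemma l2_inner_scale_right: "l2_inner a b f (\<lambda>t. c * g t) = c * l2_inner a b f g"
  by (simp add: l2_inner_def mult.left_commute)

lemma l2_inner_diff_self:
  assumes "continuous_on {a..b} f" "continuous_on {a..b} g"
  shows "l2_inner a b (\<lambda>t. f t - g t) (\<lambda>t. f t - g t)
           = l2_inner a b f f - 2 * l2_inner a b f g + l2_inner a b g g"
proof -
  have i: "(\<lambda>t. f t * f t) integrable_on {a..b}" "(\<lambda>t. f t * g t) integrable_on {a..b}"
    "(\<lambda>t. g t * g t) integrable_on {a..b}"
    by (intro integrable_continuous_real continuous_intros assms)+
  have "(\<lambda>t. (f t - g t) * (f t - g t)) = (\<lambda>t. f t * f t - 2 * (f t * g t) + g t * g t)"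
    by (auto simp: algebra_simps)
  then show ?thesis
    unfolding l2_inner_def
    by (simp add: i integral_add integral_diff integrable_diff integrable_on_mult_right)
qed

lemma l2_inner_self_nonneg:
  assumes "continuous_on {a..b} f"
  shows "0 \<le> l2_inner a b f f"
  unfolding l2_inner_def
  by (intro integral_nonneg integrable_continuous_real continuous_intros assms) auto

text \<open>A nonnegative continuous integrand with integral 0 vanishes everywhere, not just almost
  everywhere. On a one-point interval every integral is 0, hence \<open>a < b\<close>.\<close>

lemma l2_inner_self_eq_0_iff:
  assumes "continuous_on {a..b} f" "a < b"
  shows "l2_inner a b f f = 0 \<longleftrightarrow> (\<forall>t\<in>{a..b}. f t = 0)"
  unfolding l2_inner_def
  by (subst integral_eq_0_iff) (auto intro!: continuous_intros assms)

lemma l2_inner_Cauchy_Schwarz: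
  assumes f: "continuous_on {a..b} f" and g: "continuous_on {a..b} g" and ab: "a < b"
  shows "(l2_inner a b f g)\<^sup>2 \<le> l2_inner a b f f * l2_inner a b g g"
proof (cases "l2_inner a b g g = 0")
  case True
  then have "l2_inner a b f g = 0"
    using l2_inner_self_eq_0_iff[OF g ab] unfolding l2_inner_def
    by (intro integral_unique has_integral_is_0) auto
  then show ?thesis by (simp add: True)
next
  case False
  then have pos: "0 < l2_inner a b g g"
    using l2_inner_self_nonneg[OF g] by linarith
  \<comment> \<open>The coefficient of the projection of \<open>f\<close> on \<open>g\<close>, which
    minimises the norm of f - c g.\<close>
  define c where "c = l2_inner a b f g / l2_inner a b g g"
  have "0 \<le> l2_inner a b (\<lambda>t. f t - c * g t) (\<lambda>t. f t - c * g t)"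
    by (intro l2_inner_self_nonneg continuous_intros f g)
  also have "\<dots> = l2_inner a b f f - 2 * c * l2_inner a b f g + c\<^sup>2 * l2_inner a b g g"
    by (subst l2_inner_diff_self)
      (auto intro!: continuous_intros f g
        simp: l2_inner_scale_left l2_inner_scale_right power2_eq_square)
  also have "\<dots> = l2_inner a b f f - (l2_inner a b f g)\<^sup>2 / l2_inner a b g g"
    using pos by (simp add: c_def field_simps power2_eq_square)
  finally show ?thesis
    using pos by (simp add: field_simps)
qed

lemma tendsto_integral_uniform_limit:
  fixes f :: "'i \<Rightarrow> real \<Rightarrow> real"
  assumes "uniform_limit {a..b} f g F" "\<And>n. continuous_on {a..b} (f n)" "F \<noteq> bot"
  shows "((\<lambda>n. integral {a..b} (f n)) \<longlongrightarrow> integral {a..b} g) F"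
proof -
  obtain I J where I: "\<And>n. (f n has_integral I n) {a..b}" "(g has_integral J) {a..b}" "(I \<longlongrightarrow> J) F"
    using uniform_limit_integral_cbox[where a=a and b=b and f=f and g=g and F=F] assms by auto
  then have "I = (\<lambda>n. integral {a..b} (f n))" "J = integral {a..b} g"
    by (auto intro: integral_unique[symmetric])
  with I(3) show ?thesis by simp
qed

section \<open>The integral operator of a continuous symmetric kernel\<close>

locale symmetric_kernel =
  fixes a b :: real and k :: "real \<Rightarrow> real \<Rightarrow> real"
  assumes less: "a < b"
    and cont: "continuous_on ({a..b} \<times> {a..b}) (\<lambda>(s, t). k s t)"
    and sym: "s \<in> {a..b} \<Longrightarrow> t \<in> {a..b} \<Longrightarrow> k s t = k t s"
begin

definition kop :: "(real \<Rightarrow> real) \<Rightarrow> real \<Rightarrow> real" where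
  "kop f s = integral {a..b} (\<lambda>t. k s t * f t)"

abbreviation ip :: "(real \<Rightarrow> real) \<Rightarrow> (real \<Rightarrow> real) \<Rightarrow> real" where
  "ip \<equiv> l2_inner a b"

lemma continuous_on_kernel_fst: "s \<in> {a..b} \<Longrightarrow> continuous_on {a..b} (k s)"
  by (rule continuous_on_compose2[OF cont, of _ "\<lambda>t. (s, t)", simplified])
    (auto intro!: continuous_intros)

lemma kop_eq_ip: "kop f s = ip (k s) f"
  by (simp add: kop_def l2_inner_def)

lemma continuous_on_kernel_mult:
  assumes "continuous_on {a..b} f" "continuous_on {a..b} g"
  shows "continuous_on ({a..b} \<times> {a..b}) (\<lambda>(s, t). f s * (k s t * g t))"
  unfolding split_beta
  by (intro continuous_intros continuous_on_compose2[OF assms(1)]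
      continuous_on_compose2[OF assms(2)] cont[unfolded split_beta]) auto

lemma continuous_on_kop:
  assumes "continuous_on {a..b} f"
  shows "continuous_on {a..b} (kop f)"
  unfolding kop_def
  using integral_continuous_on_param[of "{a..b}" a b "\<lambda>s t. k s t * f t"]
    continuous_on_kernel_mult[OF continuous_on_const[of _ 1] assms]
  by simp

text \<open>Exchanging the two integrals over the square and then the arguments of \<open>k\<close>
  moves the operator to the other factor. Symmetry of \<open>k\<close> enters the spectral argument
  here.\<close>

lemma kop_adjoint:
  assumes f: "continuous_on {a..b} f" and g: "continuous_on {a..b} g"
  shows "ip f (kop g) = ip (kop f) g"
proof -
  have "ip f (kop g) = integral {a..b} (\<lambda>s. integral {a..b} (\<lambda>t. f s * (k s t * g t)))"
    by (simp add: l2_inner_def kop_def)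
  also have "\<dots> = integral {a..b} (\<lambda>t. integral {a..b} (\<lambda>s. f s * (k s t * g t)))"
    using integral_swap_continuous[of a a b b "\<lambda>s t. f s * (k s t * g t)"]
      continuous_on_kernel_mult[OF f g]
    by (simp add: cbox_Pair_eq)
  also have "\<dots> = integral {a..b} (\<lambda>t. integral {a..b} (\<lambda>s. (k t s * f s) * g t))"
    by (intro integral_cong) (auto simp: sym algebra_simps)
  also have "\<dots> = ip (kop f) g"
    by (simp add: l2_inner_def kop_def)
  finally show ?thesis .
qed

lemma kop_diff:
  assumes "continuous_on {a..b} f" "continuous_on {a..b} g" "s \<in> {a..b}"
  shows "kop (\<lambda>t. f t - g t) s = kop f s - kop g s"
proof -
  have "(\<lambda>t. k s t * f t) integrable_on {a..b}" "(\<lambda>t. k s t * g t) integrable_on {a..b}"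
    by (intro integrable_continuous_real continuous_intros continuous_on_kernel_fst assms)+
  then show ?thesis
    unfolding kop_def by (simp add: right_diff_distrib integral_diff)
qed

lemma kop_scale: "kop (\<lambda>t. c * f t) s = c * kop f s"
  by (simp add: kop_def mult.left_commute)

text \<open>Cauchy--Schwarz against the rows \<open>k s\<close>, whose norms are bounded because
  they depend continuously on \<open>s\<close> in a compact interval. It converts smallness in L_2
  into smallness at every point; the power iteration uses it in this way.\<close>

lemma kop_bound:
  obtains B where "0 < B"
    "\<And>f s. continuous_on {a..b} f \<Longrightarrow> s \<in> {a..b} \<Longrightarrow> (kop f s)\<^sup>2 \<le> B * ip f f"
proof -
  have "continuous_on {a..b} (\<lambda>s. ip (k s) (k s))"
    unfolding l2_inner_def
    using integral_continuous_on_param[of "{a..b}" a b "\<lambda>s t. k s t * k s t"] cont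
    by (simp add: split_beta continuous_on_mult)
  then have "bounded ((\<lambda>s. ip (k s) (k s)) ` {a..b})"
    by (intro compact_imp_bounded compact_continuous_image) auto
  then obtain B where B: "0 < B" "\<And>s. s \<in> {a..b} \<Longrightarrow> \<bar>ip (k s) (k s)\<bar> \<le> B"
    by (auto simp: bounded_pos)
  show ?thesis
  proof
    fix f :: "real \<Rightarrow> real" and s
    assume f: "continuous_on {a..b} f" and s: "s \<in> {a..b}"
    have "(kop f s)\<^sup>2 \<le> ip (k s) (k s) * ip f f"
      unfolding kop_eq_ip by (intro l2_inner_Cauchy_Schwarz continuous_on_kernel_fst f s less)
    also have "\<dots> \<le> B * ip f f"
      using B(2)[OF s] l2_inner_self_nonneg[OF f] by (intro mult_right_mono) auto
    finally show "(kop f s)\<^sup>2 \<le> B * ip f f" .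
  qed fact
qed

text \<open>Cauchy--Schwarz against the difference of two rows, which is small by uniform continuity
  of \<open>k\<close>. Since \<open>d\<close> depends on \<open>e\<close> alone, the images of the
  unit ball are equicontinuous, as Arzela--Ascoli requires.\<close>

lemma kop_equicontinuous:
  assumes "0 < e"
  obtains d where "0 < d"
    "\<And>f s s'. continuous_on {a..b} f \<Longrightarrow> ip f f \<le> 1 \<Longrightarrow> s \<in> {a..b} \<Longrightarrow> s' \<in> {a..b} \<Longrightarrow>
       \<bar>s - s'\<bar> < d \<Longrightarrow> \<bar>kop f s - kop f s'\<bar> < e"
proof -
  \<comment> \<open>A row difference of size at most \<open>c\<close> has L_2 norm at most
    \<open>c * sqrt (b - a)\<close>, which is \<open>e / 2\<close>; the remaining half of
    \<open>e\<close> gives the strict inequality.\<close>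
  define c where "c = e / (2 * sqrt (b - a))"
  have c: "0 < c" using assms less by (simp add: c_def)
  have "uniformly_continuous_on ({a..b} \<times> {a..b}) (\<lambda>(s, t). k s t)"
    using cont by (intro compact_uniformly_continuous compact_Times) auto
  then obtain d where d: "0 < d" and
    dd: "\<And>p q. p \<in> {a..b} \<times> {a..b} \<Longrightarrow> q \<in> {a..b} \<times> {a..b} \<Longrightarrow> dist p q < d \<Longrightarrow>
       dist (k (fst p) (snd p)) (k (fst q) (snd q)) < c"
    using c unfolding uniformly_continuous_on_def split_beta by metis
  show ?thesis
  proof
    fix f :: "real \<Rightarrow> real" and s s'
    assume f: "continuous_on {a..b} f" and f1: "ip f f \<le> 1" and s: "s \<in> {a..b}"
      and s': "s' \<in> {a..b}" and ss: "\<bar>s - s'\<bar> < d"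
    let ?h = "\<lambda>t. k s t - k s' t"
    have h: "continuous_on {a..b} ?h"
      by (intro continuous_intros continuous_on_kernel_fst s s')
    have "\<bar>?h t\<bar> \<le> c" if "t \<in> {a..b}" for t
      using dd[of "(s, t)" "(s', t)"] that s s' ss by (simp add: dist_Pair_Pair dist_real_def)
    then have "?h t * ?h t \<le> c\<^sup>2" if "t \<in> {a..b}" for t
      using that by (metis abs_le_square_iff abs_of_pos c power2_eq_square)
    then have "ip ?h ?h \<le> integral {a..b} (\<lambda>_. c\<^sup>2)"
      unfolding l2_inner_def by (intro integral_le integrable_continuous_real continuous_intros h)
    also have "\<dots> = (e / 2)\<^sup>2"
      using less by (simp add: c_def power_divide power_mult_distrib) (simp add: field_simps)
    finally have hh: "ip ?h ?h \<le> (e / 2)\<^sup>2" .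
    have "kop f s - kop f s' = ip ?h f"
    proof -
      have "(\<lambda>t. k s t * f t) integrable_on {a..b}" "(\<lambda>t. k s' t * f t) integrable_on {a..b}"
        by (intro integrable_continuous_real continuous_intros continuous_on_kernel_fst f s s')+
      then show ?thesis
        unfolding kop_def l2_inner_def by (simp add: left_diff_distrib integral_diff)
    qed
    then have "(kop f s - kop f s')\<^sup>2 \<le> ip ?h ?h * ip f f"
      using l2_inner_Cauchy_Schwarz[OF h f less] by simp
    also have "\<dots> \<le> (e / 2)\<^sup>2 * 1"
      using hh f1 l2_inner_self_nonneg[OF f] by (intro mult_mono) auto
    finally have "\<bar>kop f s - kop f s'\<bar> \<le> e / 2"
      using assms by (simp add: abs_le_square_iff[symmetric])
    then show "\<bar>kop f s - kop f s'\<bar> < e"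
      using assms by simp
  qed fact
qed


lemma kop_norm_bound:
  obtains B where "0 < B"
    "\<And>f. continuous_on {a..b} f \<Longrightarrow> ip (kop f) (kop f) \<le> B * ip f f"
proof -
  obtain B where B: "0 < B"
    "\<And>f s. continuous_on {a..b} f \<Longrightarrow> s \<in> {a..b} \<Longrightarrow> (kop f s)\<^sup>2 \<le> B * ip f f"
    using kop_bound by metis
  show ?thesis
  proof
    show "0 < B * (b - a)" using B(1) less by simp
    fix f :: "real \<Rightarrow> real"
    assume f: "continuous_on {a..b} f"
    have "ip (kop f) (kop f) \<le> integral {a..b} (\<lambda>_. B * ip f f)"
      unfolding l2_inner_def[of a b "kop f" "kop f"] power2_eq_square[symmetric]
      by (intro integral_le integrable_continuous_real continuous_intros continuous_on_kop f B(2))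
    then show "ip (kop f) (kop f) \<le> B * (b - a) * ip f f"
      using less by (simp add: algebra_simps)
  qed
qed

text \<open>
  Power iteration with \<open>L\<^sub>2\<close>-normalisation. The norms \<open>A n\<close> increase, so consecutive even (and odd)
  iterates approach each other, and equicontinuity of the image of the unit ball yields a limit \<open>g\<close>
  with \<open>kop (kop g) = \<mu>\<^sup>2 g\<close>; then \<open>kop g + \<mu> g\<close> or \<open>g\<close> itself is an eigenfunction.
\<close>

theorem nonzero_eigenvalue_exists:
  assumes s0: "s0 \<in> {a..b}" and t0: "t0 \<in> {a..b}" and k0: "k s0 t0 \<noteq> 0"
  obtains \<mu> f where "\<mu> \<noteq> 0" "continuous_on {a..b} f" "\<exists>t\<in>{a..b}. f t \<noteq> 0"
    "\<And>s. s \<in> {a..b} \<Longrightarrow> kop f s = \<mu> * f s"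
proof -
  \<comment> \<open>The row \<open>k s0\<close> is a safe start: its image at \<open>s0\<close> is
    its own squared norm, positive because \<open>k s0 t0\<close> is nonzero. So the first image
    does not vanish.\<close>
  define F where "F = rec_nat (\<lambda>t. (1 / sqrt (ip (k s0) (k s0))) * k s0 t)
    (\<lambda>_ f t. (1 / sqrt (ip (kop f) (kop f))) * kop f t)"
  define A where "A n = sqrt (ip (kop (F n)) (kop (F n)))" for n
  have F_0: "F 0 = (\<lambda>t. (1 / sqrt (ip (k s0) (k s0))) * k s0 t)"
    and F_Suc: "F (Suc n) = (\<lambda>t. (1 / A n) * kop (F n) t)" for n
    by (simp_all add: F_def A_def)
  have pos: "0 < ip f f" if "continuous_on {a..b} f" "t \<in> {a..b}" "f t \<noteq> 0" for f t
    using l2_inner_self_nonneg[OF that(1)] l2_inner_self_eq_0_iff[OF that(1) less] that(2,3)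
    by force
  have F: "continuous_on {a..b} (F n) \<and> ip (F n) (F n) = 1 \<and> 0 < A n" for n
  proof (induction n)
    case 0
    have p: "0 < ip (k s0) (k s0)"
      using pos[OF continuous_on_kernel_fst t0 k0] s0 by simp
    have c: "continuous_on {a..b} (F 0)"
      unfolding F_0 by (intro continuous_intros continuous_on_kernel_fst s0)
    have "kop (F 0) s0 \<noteq> 0"
      using p unfolding F_0 by (subst kop_scale) (simp add: kop_eq_ip)
    then have "0 < A 0"
      using pos[OF continuous_on_kop[OF c] s0] by (simp add: A_def)
    moreover have "ip (F 0) (F 0) = 1"
      using p unfolding F_0 by (subst l2_inner_scale_left, subst l2_inner_scale_right) simp
    ultimately show ?case using c by simp
  next
    case (Suc n)
    then have c: "continuous_on {a..b} (F n)" and F1: "ip (F n) (F n) = 1" and An: "0 < A n"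
      by auto
    have A2: "ip (kop (F n)) (kop (F n)) = (A n)\<^sup>2"
      using l2_inner_self_nonneg[OF continuous_on_kop[OF c]] by (simp add: A_def)
    have c': "continuous_on {a..b} (F (Suc n))"
      unfolding F_Suc by (intro continuous_intros continuous_on_kop c)
    have one: "ip (F (Suc n)) (F (Suc n)) = 1"
      using An unfolding F_Suc
      by (simp only: l2_inner_scale_left l2_inner_scale_right A2) (simp add: power2_eq_square)
    \<comment> \<open>Self-adjointness moves \<open>kop\<close> to the next iterate, and
      Cauchy--Schwarz with the unit vector \<open>F n\<close> gives
      \<open>A n \<le> A (Suc n)\<close>. Positivity of \<open>A\<close> is thereby inherited, so
      normalising never divides by 0.\<close>
    have "A n = ip (kop (F n)) (F (Suc n))"
      using An unfolding F_Suc
      by (simp only: l2_inner_scale_right A2) (simp add: power2_eq_square)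
    also have "\<dots> = ip (F n) (kop (F (Suc n)))"
      by (rule kop_adjoint[OF c c', symmetric])
    finally have "(A n)\<^sup>2 \<le> ip (kop (F (Suc n))) (kop (F (Suc n)))"
      using l2_inner_Cauchy_Schwarz[OF c continuous_on_kop[OF c'] less] F1 by simp
    then have "A n \<le> A (Suc n)"
      unfolding A_def[of "Suc n"] using An by (simp add: real_le_rsqrt)
    with An c' one show ?case by simp
  qed
  then have Fc: "continuous_on {a..b} (F n)" and F1: "ip (F n) (F n) = 1" and Apos: "0 < A n" for n
    by auto
  have kc: "continuous_on {a..b} (kop (F n))" for n
    by (intro continuous_on_kop Fc)
  have A2: "ip (kop (F n)) (kop (F n)) = (A n)\<^sup>2" for n
    using l2_inner_self_nonneg[OF kc] by (simp add: A_def)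
  have Aip: "A n = ip (F n) (kop (F (Suc n)))" for n
  proof -
    have "ip (kop (F n)) (F (Suc n)) = A n"
      using Apos[of n] unfolding F_Suc
      by (simp only: l2_inner_scale_right A2) (simp add: power2_eq_square)
    then show ?thesis using kop_adjoint[OF Fc Fc] by simp
  qed
  have Amono: "A n \<le> A (Suc n)" for n
  proof -
    have "(A n)\<^sup>2 \<le> (A (Suc n))\<^sup>2"
      using l2_inner_Cauchy_Schwarz[OF Fc kc less, of n "Suc n"]
      unfolding Aip[symmetric] A2 F1 by simp
    then show ?thesis by (rule power2_le_imp_le) (use Apos[of "Suc n"] in simp)
  qed
  obtain B where B: "0 < B"
    "\<And>f. continuous_on {a..b} f \<Longrightarrow> ip (kop f) (kop f) \<le> B * ip f f"
    using kop_norm_bound by metis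
  have "A n \<le> sqrt B" for n
    unfolding A_def using B(2)[OF Fc, of n] F1[of n] by simp
  then obtain \<mu> where \<mu>: "A \<longlonglongrightarrow> \<mu>" "\<And>n. A n \<le> \<mu>"
    using incseq_convergent[of A "sqrt B"] Amono by (auto simp: incseq_Suc_iff)
  have \<mu>pos: "0 < \<mu>" using \<mu>(2)[of 0] Apos[of 0] by linarith
  \<comment> \<open>Two unit vectors with inner product \<open>A n / A (Suc n)\<close>; the quotient
    tends to 1 because \<open>A\<close> converges to a positive limit.\<close>
  have D0: "(\<lambda>n. ip (\<lambda>t. F (Suc (Suc n)) t - F n t) (\<lambda>t. F (Suc (Suc n)) t - F n t)) \<longlonglongrightarrow> 0"
  proof -
    have "ip (F (Suc (Suc n))) (F n) = A n / A (Suc n)" for n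
      unfolding F_Suc[of "Suc n"] l2_inner_scale_left l2_inner_commute[of a b _ "F n"] Aip[of n, symmetric]
      by simp
    then have *: "ip (\<lambda>t. F (Suc (Suc n)) t - F n t) (\<lambda>t. F (Suc (Suc n)) t - F n t)
        = 2 - 2 * (A n / A (Suc n))" for n
      by (simp add: l2_inner_diff_self[OF Fc Fc] F1)
    have "(\<lambda>n. 2 - 2 * (A n / A (Suc n))) \<longlonglongrightarrow> 2 - 2 * (\<mu> / \<mu>)"
      using \<mu>pos by (intro tendsto_intros \<mu>(1) LIMSEQ_Suc[OF \<mu>(1)]) auto
    then show ?thesis using \<mu>pos by (simp add: *)
  qed
  obtain C where C: "0 < C"
    "\<And>f s. continuous_on {a..b} f \<Longrightarrow> s \<in> {a..b} \<Longrightarrow> (kop f s)\<^sup>2 \<le> C * ip f f"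
    using kop_bound by metis
  have kD0: "(\<lambda>n. kop (F (Suc (Suc n))) s - kop (F n) s) \<longlonglongrightarrow> 0" if s: "s \<in> {a..b}" for s
  proof -
    have le: "(kop (F (Suc (Suc n))) s - kop (F n) s)\<^sup>2
        \<le> C * ip (\<lambda>t. F (Suc (Suc n)) t - F n t) (\<lambda>t. F (Suc (Suc n)) t - F n t)" for n
      unfolding kop_diff[OF Fc Fc s, symmetric]
      by (intro C(2) continuous_intros Fc s)
    have "(\<lambda>n. C * ip (\<lambda>t. F (Suc (Suc n)) t - F n t) (\<lambda>t. F (Suc (Suc n)) t - F n t)) \<longlonglongrightarrow> 0"
      by (rule tendsto_mult_right_zero[OF D0])
    then have "(\<lambda>n. (kop (F (Suc (Suc n))) s - kop (F n) s)\<^sup>2) \<longlonglongrightarrow> 0"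
      by (rule Lim_null_comparison[rotated]) (use le in simp)
    then show ?thesis by simp
  qed
  have kbound: "\<bar>kop (F n) s\<bar> \<le> sqrt C" if "s \<in> {a..b}" for n s
    using C(2)[OF Fc that, of n] F1 by (simp add: real_le_rsqrt)
  \<comment> \<open>Iterates from index 1 on are images under \<open>kop\<close>, for which L_2
    smallness gives pointwise smallness; hence the extra \<open>Suc\<close>. The second summand in
    the splitting accounts for the change of the normalising factor.\<close>
  have FD0: "(\<lambda>n. F (Suc (Suc (Suc n))) s - F (Suc n) s) \<longlonglongrightarrow> 0" if s: "s \<in> {a..b}" for s
  proof -
    have eq: "F (Suc (Suc (Suc n))) s - F (Suc n) s
        = (1 / A (Suc (Suc n))) * (kop (F (Suc (Suc n))) s - kop (F n) s)
          + (1 / A (Suc (Suc n)) - 1 / A n) * kop (F n) s" for n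
      by (simp add: F_Suc[of "Suc (Suc n)"] F_Suc[of n] algebra_simps)
    have A': "(\<lambda>n. 1 / A (Suc (Suc n))) \<longlonglongrightarrow> 1 / \<mu>" "(\<lambda>n. 1 / A n) \<longlonglongrightarrow> 1 / \<mu>"
      using \<mu>pos by (intro tendsto_intros \<mu>(1) LIMSEQ_Suc[OF LIMSEQ_Suc[OF \<mu>(1)]]; simp)+
    have "(\<lambda>n. (1 / A (Suc (Suc n)) - 1 / A n) * kop (F n) s) \<longlonglongrightarrow> 0"
    proof (rule Lim_null_comparison)
      show "\<forall>\<^sub>F n in sequentially. norm ((1 / A (Suc (Suc n)) - 1 / A n) * kop (F n) s)
          \<le> \<bar>1 / A (Suc (Suc n)) - 1 / A n\<bar> * sqrt C"
        using kbound[OF s] by (auto simp: abs_mult intro!: mult_left_mono always_eventually)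
      have "(\<lambda>n. 1 / A (Suc (Suc n)) - 1 / A n) \<longlonglongrightarrow> 0"
        using tendsto_diff[OF A'] by simp
      then show "(\<lambda>n. \<bar>1 / A (Suc (Suc n)) - 1 / A n\<bar> * sqrt C) \<longlonglongrightarrow> 0"
        by (intro tendsto_mult_left_zero tendsto_rabs_zero)
    qed
    moreover have "(\<lambda>n. (1 / A (Suc (Suc n))) * (kop (F (Suc (Suc n))) s - kop (F n) s)) \<longlonglongrightarrow> 0"
      using tendsto_mult[OF A'(1) kD0[OF s]] by simp
    ultimately show ?thesis
      unfolding eq using tendsto_add by fastforce
  qed
  \<comment> \<open>Every iterate from index 1 on is the image of a unit vector divided by some
    \<open>A n \<ge> A 0\<close>. The bound and the modulus of continuity of \<open>kop\<close> on
    the unit ball carry over after division by \<open>A 0\<close>.\<close>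
  obtain g \<sigma> where g: "continuous_on {a..b} g" and \<sigma>: "strict_mono (\<sigma> :: nat \<Rightarrow> nat)"
    and lim: "\<And>e. 0 < e \<Longrightarrow> \<exists>N. \<forall>n x. n \<ge> N \<and> x \<in> {a..b} \<longrightarrow> norm (F (Suc (\<sigma> n)) x - g x) < e"
  proof (rule Arzela_Ascoli[of "{a..b}" "\<lambda>n. F (Suc n)" "sqrt C / A 0"])
    have A0: "A 0 \<le> A n" for n
      using lift_Suc_mono_le[of A 0 n] Amono by auto
    show "norm (F (Suc n) x) \<le> sqrt C / A 0" if "x \<in> {a..b}" for n x
    proof -
      have "\<bar>kop (F n) x\<bar> / A n \<le> sqrt C / A 0"
        using kbound[OF that, of n] A0[of n] Apos by (intro frac_le) (auto simp: C(1) less_imp_le)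
      then show ?thesis using Apos[of n] by (simp add: F_Suc abs_mult)
    qed
    show "\<exists>d. 0 < d \<and> (\<forall>n y. y \<in> {a..b} \<and> norm (x - y) < d \<longrightarrow> norm (F (Suc n) x - F (Suc n) y) < e)"
      if x: "x \<in> {a..b}" and e: "0 < e" for x e
    proof -
      obtain d where d: "0 < d" "\<And>f s s'. continuous_on {a..b} f \<Longrightarrow> ip f f \<le> 1 \<Longrightarrow> s \<in> {a..b} \<Longrightarrow> s' \<in> {a..b} \<Longrightarrow>
         \<bar>s - s'\<bar> < d \<Longrightarrow> \<bar>kop f s - kop f s'\<bar> < e * A 0"
        using kop_equicontinuous[of "e * A 0"] e Apos[of 0] by (metis mult_pos_pos)
      have "norm (F (Suc n) x - F (Suc n) y) < e" if "y \<in> {a..b}" "norm (x - y) < d" for n y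
      proof -
        have "\<bar>kop (F n) x - kop (F n) y\<bar> < e * A 0"
          using d(2)[OF Fc _ x that(1)] that(2) F1 by simp
        also have "\<dots> \<le> e * A n" using A0[of n] e by simp
        finally have "\<bar>kop (F n) x - kop (F n) y\<bar> / A n < e"
          using Apos[of n] by (simp add: field_simps)
        moreover have "F (Suc n) x - F (Suc n) y = (kop (F n) x - kop (F n) y) / A n"
          by (simp add: F_Suc diff_divide_distrib)
        ultimately show ?thesis using Apos[of n] by (simp add: abs_divide)
      qed
      with d(1) show ?thesis by blast
    qed
  qed auto
  have unif: "uniform_limit {a..b} (\<lambda>n. F (Suc (\<sigma> n))) g sequentially"
    unfolding uniform_limit_sequentially_iff dist_norm using lim by blast
  have "(\<lambda>n. ip (F (Suc (\<sigma> n))) (F (Suc (\<sigma> n)))) \<longlonglongrightarrow> ip g g"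
    unfolding l2_inner_def
    by (intro tendsto_integral_uniform_limit uniform_lim_mult unif compact_imp_bounded
        compact_continuous_image g continuous_intros Fc) auto
  then have ipg: "ip g g = 1"
    by (simp add: F1 LIMSEQ_const_iff)
  have ip0: "(\<lambda>n. ip (\<lambda>t. F (Suc (\<sigma> n)) t - g t) (\<lambda>t. F (Suc (\<sigma> n)) t - g t)) \<longlonglongrightarrow> 0"
  proof -
    have "uniform_limit {a..b} (\<lambda>n t. F (Suc (\<sigma> n)) t - g t) (\<lambda>t. g t - g t) sequentially"
      by (intro uniform_limit_minus unif uniform_limit_const)
    then have "uniform_limit {a..b} (\<lambda>n t. F (Suc (\<sigma> n)) t - g t) (\<lambda>t. 0) sequentially"
      by simp
    then have "(\<lambda>n. ip (\<lambda>t. F (Suc (\<sigma> n)) t - g t) (\<lambda>t. F (Suc (\<sigma> n)) t - g t))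
        \<longlonglongrightarrow> integral {a..b} (\<lambda>t. 0 * 0)"
      unfolding l2_inner_def
      by (intro tendsto_integral_uniform_limit uniform_lim_mult continuous_intros Fc g)
        (auto simp: image_constant_conv)
    then show ?thesis by simp
  qed
  \<comment> \<open>Two applications of the recursion write \<open>kop (kop (F (Suc m)))\<close> as
    \<open>A (Suc m) * A (Suc (Suc m))\<close> times the iterate two places later. Along
    \<open>\<sigma>\<close> both iterates tend to \<open>g\<close>, since they differ by a null
    sequence.\<close>
  have kk: "kop (kop g) s = \<mu>\<^sup>2 * g s" if s: "s \<in> {a..b}" for s
  proof -
    have gs: "(\<lambda>n. F (Suc (\<sigma> n)) s) \<longlonglongrightarrow> g s"
      using tendsto_uniform_limitI[OF unif s] .
    have "(\<lambda>n. F (Suc (Suc (Suc (\<sigma> n)))) s) \<longlonglongrightarrow> g s"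
      using tendsto_add[OF gs LIMSEQ_subseq_LIMSEQ[OF FD0[OF s] \<sigma>]] by (simp add: o_def)
    moreover have "(\<lambda>n. A (Suc (\<sigma> n))) \<longlonglongrightarrow> \<mu>" "(\<lambda>n. A (Suc (Suc (\<sigma> n)))) \<longlonglongrightarrow> \<mu>"
      using LIMSEQ_subseq_LIMSEQ[OF LIMSEQ_Suc[OF \<mu>(1)] \<sigma>]
        LIMSEQ_subseq_LIMSEQ[OF LIMSEQ_Suc[OF LIMSEQ_Suc[OF \<mu>(1)]] \<sigma>] by (simp_all add: o_def)
    ultimately have "(\<lambda>n. A (Suc (\<sigma> n)) * A (Suc (Suc (\<sigma> n))) * F (Suc (Suc (Suc (\<sigma> n)))) s)
        \<longlonglongrightarrow> \<mu> * \<mu> * g s"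
      by (intro tendsto_mult)
    moreover have "A (Suc m) * A (Suc (Suc m)) * F (Suc (Suc (Suc m))) s = kop (kop (F (Suc m))) s" for m
    proof -
      have "kop (F (Suc (Suc m))) s = (1 / A (Suc m)) * kop (kop (F (Suc m))) s"
        unfolding F_Suc[of "Suc m"] by (rule kop_scale)
      then show ?thesis
        using Apos[of "Suc m"] Apos[of "Suc (Suc m)"] by (simp add: F_Suc[of "Suc (Suc m)"])
    qed
    ultimately have 1: "(\<lambda>n. kop (kop (F (Suc (\<sigma> n)))) s) \<longlonglongrightarrow> \<mu> * \<mu> * g s"
      by simp
    have "(\<lambda>n. (kop (kop (F (Suc (\<sigma> n)))) s - kop (kop g) s)\<^sup>2) \<longlonglongrightarrow> 0"
    proof (rule tendsto_sandwich[OF _ _ tendsto_const])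
      show "\<forall>\<^sub>F n in sequentially. (kop (kop (F (Suc (\<sigma> n)))) s - kop (kop g) s)\<^sup>2
          \<le> C * (B * ip (\<lambda>t. F (Suc (\<sigma> n)) t - g t) (\<lambda>t. F (Suc (\<sigma> n)) t - g t))"
      proof (intro always_eventually allI)
        fix n
        let ?v = "\<lambda>t. F (Suc (\<sigma> n)) t - g t"
        have v: "continuous_on {a..b} ?v" by (intro continuous_intros Fc g)
        have "kop (kop (F (Suc (\<sigma> n)))) s - kop (kop g) s
            = kop (\<lambda>t. kop (F (Suc (\<sigma> n))) t - kop g t) s"
          by (intro kop_diff[symmetric] kc continuous_on_kop g s)
        also have "\<dots> = kop (kop ?v) s"
          unfolding kop_def[of "kop ?v"] kop_def[of "\<lambda>t. kop (F (Suc (\<sigma> n))) t - kop g t"]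
          by (intro integral_cong) (simp add: kop_diff[OF Fc g])
        finally have "(kop (kop (F (Suc (\<sigma> n)))) s - kop (kop g) s)\<^sup>2 \<le> C * ip (kop ?v) (kop ?v)"
          using C(2)[OF continuous_on_kop[OF v] s] by simp
        also have "\<dots> \<le> C * (B * ip ?v ?v)"
          using B(2)[OF v] C(1) by simp
        finally show "(kop (kop (F (Suc (\<sigma> n)))) s - kop (kop g) s)\<^sup>2 \<le> C * (B * ip ?v ?v)" .
      qed
      show "(\<lambda>n. C * (B * ip (\<lambda>t. F (Suc (\<sigma> n)) t - g t) (\<lambda>t. F (Suc (\<sigma> n)) t - g t))) \<longlonglongrightarrow> 0"
        by (intro tendsto_mult_right_zero ip0)
    qed auto
    then have "(\<lambda>n. kop (kop (F (Suc (\<sigma> n)))) s - kop (kop g) s) \<longlonglongrightarrow> 0"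
      by simp
    then have "(\<lambda>n. kop (kop (F (Suc (\<sigma> n)))) s) \<longlonglongrightarrow> kop (kop g) s"
      by (simp add: LIM_zero_iff)
    with 1 show ?thesis
      using LIMSEQ_unique by (fastforce simp: power2_eq_square)
  qed
  \<comment> \<open>With T for \<open>kop\<close>, the relation reads (T - \<mu>)(T + \<mu>) g = 0.
    Either T + \<mu> kills \<open>g\<close>, and \<open>- \<mu>\<close> is an eigenvalue, or it maps
    \<open>g\<close> to an eigenfunction for \<open>\<mu>\<close>.\<close>
  show ?thesis
  proof (cases "\<forall>s\<in>{a..b}. kop g s + \<mu> * g s = 0")
    case True
    show ?thesis
    proof
      show "- \<mu> \<noteq> 0" using \<mu>pos by simp
      show "\<exists>t\<in>{a..b}. g t \<noteq> 0"
        using ipg l2_inner_self_eq_0_iff[OF g less] by auto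
      show "kop g s = - \<mu> * g s" if "s \<in> {a..b}" for s
        using True that by force
    qed (rule g)
  next
    case False
    let ?h = "\<lambda>s. kop g s - (- \<mu>) * g s"
    show ?thesis
    proof
      show "\<mu> \<noteq> 0" using \<mu>pos by simp
      show "continuous_on {a..b} ?h" by (intro continuous_intros continuous_on_kop g)
      show "\<exists>t\<in>{a..b}. ?h t \<noteq> 0" using False by simp
      show "kop ?h s = \<mu> * ?h s" if s: "s \<in> {a..b}" for s
      proof -
        have "kop ?h s = kop (kop g) s - kop (\<lambda>t. (- \<mu>) * g t) s"
          by (intro kop_diff continuous_on_kop continuous_intros g s)
        also have "\<dots> = \<mu>\<^sup>2 * g s + \<mu> * kop g s"
          unfolding kop_scale kk[OF s] by simp
        finally show ?thesis by (simp add: power2_eq_square algebra_simps)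
      qed
    qed
  qed
qed

end

subsection \<open>Mercer expansion on the diagonal\<close>

lemma set_lebesgue_integral_continuous_eq:
  fixes f :: "real \<Rightarrow> real"
  assumes "continuous_on {a..b} f"
  shows "(LBINT t:{a..b}. f t) = integral {a..b} f"
  by (intro set_borel_integral_eq_integral borel_integrable_atLeastAtMost' assms)

text \<open>The square roots of the weights are absorbed into the two factors. With
  \<open>w = lam\<close> this bounds the expansion of the kernel off the diagonal by its values on
  the diagonal.\<close>

lemma weighted_Cauchy_Schwarz_sum:
  fixes w u v :: "'a \<Rightarrow> real"
  assumes "\<And>k. k \<in> I \<Longrightarrow> 0 \<le> w k"
  shows "(\<Sum>k\<in>I. w k * u k * v k)\<^sup>2 \<le> (\<Sum>k\<in>I. w k * (u k)\<^sup>2) * (\<Sum>k\<in>I. w k * (v k)\<^sup>2)"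
proof -
  have "(\<Sum>k\<in>I. w k * u k * v k) = (\<Sum>k\<in>I. (sqrt (w k) * u k) * (sqrt (w k) * v k))"
    using assms by (intro sum.cong) (auto simp: algebra_simps)
  moreover have "(\<Sum>k\<in>I. w k * (u k)\<^sup>2) = (\<Sum>k\<in>I. (sqrt (w k) * u k)\<^sup>2)" for u
    using assms by (intro sum.cong) (auto simp: power_mult_distrib)
  ultimately show ?thesis
    using Cauchy_Schwarz_ineq_sum[of "\<lambda>k. sqrt (w k) * u k" "\<lambda>k. sqrt (w k) * v k" I] by simp
qed

text \<open>
  Mercer's theorem on the diagonal. The kernel left after removing all listed eigenpairs is
  continuous; were it nonzero, it would have an eigenfunction for a nonzero eigenvalue, orthogonal
  to every listed one and yet an eigenfunction of \<open>c\<close>, against exhaustiveness of the list.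
\<close>

theorem mercer_diagonal:
  fixes c :: "real \<Rightarrow> real \<Rightarrow> real"
  assumes \<tau>: "0 < \<tau>"
    and cont: "continuous_on ({0..\<tau>} \<times> {0..\<tau>}) (\<lambda>(s, t). c s t)"
    and sym: "\<And>s t. s \<in> {0..\<tau>} \<Longrightarrow> t \<in> {0..\<tau>} \<Longrightarrow> c s t = c t s"
    and eig: "eigensystem \<tau> c lam phi"
    and lam: "\<And>k. 1 \<le> k \<Longrightarrow> 0 \<le> lam k"
    and diag: "\<And>m t. t \<in> {0..\<tau>} \<Longrightarrow> (\<Sum>k=1..m. lam k * (phi k t)\<^sup>2) \<le> c t t"
    and incr: "\<And>m s t. s \<in> {0..\<tau>} \<Longrightarrow> t \<in> {0..\<tau>} \<Longrightarrow>
      (\<Sum>k=1..m. lam k * (phi k t - phi k s)\<^sup>2) \<le> K * (t - s)\<^sup>2"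
    and t0: "t0 \<in> {0..\<tau>}"
  shows "(\<lambda>m. \<Sum>k=1..m. lam k * (phi k t0)\<^sup>2) \<longlonglongrightarrow> c t0 t0"
proof -
  define p where "p m s t = (\<Sum>k=1..m. lam k * phi k s * phi k t)" for m s t
  have phic: "continuous_on {0..\<tau>} (phi k)" if "1 \<le> k" for k
    using eig that by (auto simp: eigensystem_def eigenfunction_def)
  have csec: "continuous_on {0..\<tau>} (c s)" if "s \<in> {0..\<tau>}" for s
    by (rule continuous_on_compose2[OF cont, of _ "\<lambda>t. (s, t)", simplified])
      (use that in \<open>auto intro!: continuous_intros\<close>)
  have orth: "l2_inner 0 \<tau> (phi j) (phi k) = (if j = k then 1 else 0)" if "1 \<le> j" "1 \<le> k" for j k
  proof -
    have "(LBINT t:{0..\<tau>}. phi j t * phi k t) = (if j = k then 1 else 0)"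
      using eig that by (auto simp: eigensystem_def)
    then show ?thesis
      by (subst (asm) set_lebesgue_integral_continuous_eq)
        (auto simp: l2_inner_def intro!: continuous_intros phic that)
  qed
  have eigk: "integral {0..\<tau>} (\<lambda>t. c s t * phi k t) = lam k * phi k s"
    if "1 \<le> k" "s \<in> {0..\<tau>}" for k s
  proof -
    have "(LBINT t:{0..\<tau>}. c s t * phi k t) = lam k * phi k s"
      using eig that by (auto simp: eigensystem_def eigenfunction_def)
    then show ?thesis
      by (subst (asm) set_lebesgue_integral_continuous_eq)
        (auto intro!: continuous_intros csec phic that)
  qed
  obtain C where C: "\<And>t. t \<in> {0..\<tau>} \<Longrightarrow> c t t \<le> C"
  proof -
    have "continuous_on {0..\<tau>} (\<lambda>t. c t t)"
      by (rule continuous_on_compose2[OF cont, of _ "\<lambda>t. (t, t)", simplified])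
        (auto intro!: continuous_intros)
    then show ?thesis
    proof (rule continuous_on_compact_abs_bound[OF compact_Icc])
      fix B assume B: "\<And>t. t \<in> {0..\<tau>} \<Longrightarrow> \<bar>c t t\<bar> \<le> B"
      show ?thesis by (rule that, rule abs_le_D1, rule B)
    qed
  qed
  have C0: "0 \<le> C" using C[of 0] diag[of 0 0] \<tau> by simp
  have K0: "0 \<le> K" using incr[of 0 \<tau> 0] \<tau> by (simp add: zero_le_mult_iff)
  have diagC: "(\<Sum>k=1..m. lam k * (phi k t)\<^sup>2) \<le> C" if "t \<in> {0..\<tau>}" for m t
    using diag[OF that, of m] C[OF that] by linarith
  have pbound: "\<bar>p m s t\<bar> \<le> C" if "s \<in> {0..\<tau>}" "t \<in> {0..\<tau>}" for m s t
  proof -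
    have "(p m s t)\<^sup>2 \<le> (\<Sum>k=1..m. lam k * (phi k s)\<^sup>2) * (\<Sum>k=1..m. lam k * (phi k t)\<^sup>2)"
      unfolding p_def by (intro weighted_Cauchy_Schwarz_sum lam) auto
    also have "\<dots> \<le> C * C"
      by (intro mult_mono diagC that C0 sum_nonneg mult_nonneg_nonneg lam) auto
    finally show ?thesis
      using C0 unfolding power2_eq_square[symmetric] abs_le_square_iff[symmetric] by simp
  qed
  \<comment> \<open>One Cauchy--Schwarz factor collects the increments of the eigenfunctions,
    bounded through \<open>K\<close>; the other is a diagonal sum, bounded by \<open>C\<close>. The
    constant does not depend on \<open>m\<close> and so passes to the limit
    \<open>h\<close>.\<close>
  have plip: "\<bar>p m s t - p m s' t\<bar> \<le> sqrt (K * C) * \<bar>s - s'\<bar>"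
    if "s \<in> {0..\<tau>}" "s' \<in> {0..\<tau>}" "t \<in> {0..\<tau>}" for m s s' t
  proof -
    have "p m s t - p m s' t = (\<Sum>k=1..m. lam k * (phi k s - phi k s') * phi k t)"
      by (simp add: p_def sum_subtractf[symmetric] algebra_simps)
    then have "(p m s t - p m s' t)\<^sup>2
        \<le> (\<Sum>k=1..m. lam k * (phi k s - phi k s')\<^sup>2) * (\<Sum>k=1..m. lam k * (phi k t)\<^sup>2)"
      using weighted_Cauchy_Schwarz_sum[of "{1..m}" lam "\<lambda>k. phi k s - phi k s'" "\<lambda>k. phi k t"] lam
      by simp
    also have "\<dots> \<le> (K * (s - s')\<^sup>2) * C"
      by (intro mult_mono diagC incr that sum_nonneg mult_nonneg_nonneg lam K0) auto
    also have "\<dots> = (sqrt (K * C) * \<bar>s - s'\<bar>)\<^sup>2"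
      using K0 C0 by (simp add: power_mult_distrib)
    finally show ?thesis
      using K0 C0 unfolding abs_le_square_iff[symmetric] by (simp add: abs_mult)
  qed
  define h where "h s t = lim (\<lambda>m. p m s t)" for s t
  have plim: "(\<lambda>m. p m s t) \<longlonglongrightarrow> h s t" if "s \<in> {0..\<tau>}" "t \<in> {0..\<tau>}" for s t
  proof -
    have "summable (\<lambda>k. lam (Suc k) * (phi (Suc k) t)\<^sup>2)" if "t \<in> {0..\<tau>}" for t
    proof (rule summableI_nonneg_bounded)
      show "(\<Sum>k<m. lam (Suc k) * (phi (Suc k) t)\<^sup>2) \<le> C" for m
        using diagC[OF that, of m] by (simp add: sum.atLeast1_atMost_eq)
    qed (simp add: lam)
    then have "summable (\<lambda>k. lam (Suc k) * (phi (Suc k) s)\<^sup>2 + lam (Suc k) * (phi (Suc k) t)\<^sup>2)"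
      using that by (intro summable_add) auto
    then have "summable (\<lambda>k. lam (Suc k) * phi (Suc k) s * phi (Suc k) t)"
    proof (rule summable_comparison_test'[where N = 0])
      fix k
      show "norm (lam (Suc k) * phi (Suc k) s * phi (Suc k) t)
          \<le> lam (Suc k) * (phi (Suc k) s)\<^sup>2 + lam (Suc k) * (phi (Suc k) t)\<^sup>2"
        using lam[of "Suc k"]
        by (simp add: abs_mult mult.assoc distrib_left[symmetric] mult_left_mono
            abs_mult_le_sum_squares[of "phi (Suc k) s" "phi (Suc k) t", unfolded abs_mult])
    qed
    then have "convergent (\<lambda>m. p m s t)"
      by (simp add: p_def sum.atLeast1_atMost_eq summable_iff_convergent)
    then show ?thesis by (simp add: h_def convergent_LIMSEQ_iff)
  qed
  \<comment> \<open>Holds for all arguments, even where the series may diverge: the two sequences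
    under \<open>lim\<close> coincide.\<close>
  have hsym: "h s t = h t s" for s t
    by (simp add: h_def p_def mult.commute mult.left_commute)
  have hlip: "\<bar>h s t - h s' t\<bar> \<le> sqrt (K * C) * \<bar>s - s'\<bar>"
    if "s \<in> {0..\<tau>}" "s' \<in> {0..\<tau>}" "t \<in> {0..\<tau>}" for s s' t
    by (rule tendsto_upperbound[OF tendsto_rabs[OF tendsto_diff[OF plim plim]]])
      (use that plip in auto)
  have hcont: "continuous_on ({0..\<tau>} \<times> {0..\<tau>}) (\<lambda>(s, t). h s t)"
  proof (rule lipschitz_on_continuous_on)
    \<comment> \<open>The arguments are moved one at a time, the second one by symmetry; this
      doubles the constant.\<close>
    show "(2 * sqrt (K * C))-lipschitz_on ({0..\<tau>} \<times> {0..\<tau>}) (\<lambda>(s, t). h s t)"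
    proof (rule lipschitz_onI)
      fix x y assume x: "x \<in> {0..\<tau>} \<times> {0..\<tau>}" and y: "y \<in> {0..\<tau>} \<times> {0..\<tau>}"
      obtain s t s' t' where [simp]: "x = (s, t)" "y = (s', t')" by fastforce
      have "\<bar>h s t - h s' t'\<bar> \<le> \<bar>h s t - h s' t\<bar> + \<bar>h t s' - h t' s'\<bar>"
        using hsym[of t s'] hsym[of t' s'] by simp
      also have "\<dots> \<le> sqrt (K * C) * \<bar>s - s'\<bar> + sqrt (K * C) * \<bar>t - t'\<bar>"
        using x y by (intro add_mono hlip) auto
      also have "\<dots> \<le> sqrt (K * C) * dist x y + sqrt (K * C) * dist x y"
        using dist_fst_le[of x y] dist_snd_le[of x y] K0 C0
        by (intro add_mono mult_left_mono) (auto simp: dist_real_def)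
      finally show "dist (case x of (s, t) \<Rightarrow> h s t) (case y of (s, t) \<Rightarrow> h s t)
          \<le> 2 * sqrt (K * C) * dist x y"
        by (simp add: dist_real_def)
    qed (use K0 C0 in auto)
  qed
  \<comment> \<open>Dominated convergence, with \<open>C * \<bar>g t\<bar>\<close> as the dominating
    function, lets the operator of \<open>h\<close> be computed from the coefficients of
    \<open>g\<close> in the listed eigenfunctions.\<close>
  have hint: "(\<lambda>m. \<Sum>k=1..m. lam k * phi k s * l2_inner 0 \<tau> (phi k) g)
      \<longlonglongrightarrow> integral {0..\<tau>} (\<lambda>t. h s t * g t)"
    if g: "continuous_on {0..\<tau>} g" and s: "s \<in> {0..\<tau>}" for g s
  proof -
    have "(\<lambda>m. integral {0..\<tau>} (\<lambda>t. p m s t * g t)) \<longlonglongrightarrow> integral {0..\<tau>} (\<lambda>t. h s t * g t)"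
    proof (rule dominated_convergence(2)[where h = "\<lambda>t. C * \<bar>g t\<bar>"])
      show "(\<lambda>t. p m s t * g t) integrable_on {0..\<tau>}" for m
        unfolding p_def by (intro integrable_continuous_real continuous_intros g phic) auto
      show "(\<lambda>t. C * \<bar>g t\<bar>) integrable_on {0..\<tau>}"
        by (intro integrable_continuous_real continuous_intros g)
      show "norm (p m s t * g t) \<le> C * \<bar>g t\<bar>" if "t \<in> {0..\<tau>}" for m t
        using pbound[OF s that] by (simp add: abs_mult mult_right_mono)
      show "(\<lambda>m. p m s t * g t) \<longlonglongrightarrow> h s t * g t" if "t \<in> {0..\<tau>}" for t
        by (intro tendsto_intros plim s that)
    qed
    moreover have "integral {0..\<tau>} (\<lambda>t. p m s t * g t)
        = (\<Sum>k=1..m. lam k * phi k s * l2_inner 0 \<tau> (phi k) g)" for m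
    proof -
      have "integral {0..\<tau>} (\<lambda>t. p m s t * g t)
          = integral {0..\<tau>} (\<lambda>t. \<Sum>k=1..m. lam k * phi k s * (phi k t * g t))"
        by (simp add: p_def sum_distrib_right mult.assoc)
      also have "\<dots> = (\<Sum>k=1..m. integral {0..\<tau>} (\<lambda>t. lam k * phi k s * (phi k t * g t)))"
        by (intro integral_sum integrable_continuous_real continuous_intros g phic) auto
      finally show ?thesis by (simp add: l2_inner_def)
    qed
    ultimately show ?thesis by simp
  qed
  define r where "r s t = c s t - h s t" for s t
  interpret r: symmetric_kernel 0 \<tau> r
  proof
    show "continuous_on ({0..\<tau>} \<times> {0..\<tau>}) (\<lambda>(s, t). r s t)"
      using continuous_on_diff[OF cont hcont] by (simp add: r_def split_beta)
    show "r s t = r t s" if "s \<in> {0..\<tau>}" "t \<in> {0..\<tau>}" for s t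
      unfolding r_def using sym[OF that] hsym[of s t] by (rule arg_cong2)
  qed (rule \<tau>)
  have kop_eq: "r.kop g s = integral {0..\<tau>} (\<lambda>t. c s t * g t) - integral {0..\<tau>} (\<lambda>t. h s t * g t)"
    if g: "continuous_on {0..\<tau>} g" and s: "s \<in> {0..\<tau>}" for g s
  proof -
    have "(\<lambda>t. c s t * g t) integrable_on {0..\<tau>}"
      by (intro integrable_continuous_real continuous_intros csec g s)
    moreover have "continuous_on {0..\<tau>} (h s)"
      by (rule continuous_on_compose2[OF hcont, of _ "\<lambda>t. (s, t)", simplified])
        (use s in \<open>auto intro!: continuous_intros\<close>)
    then have "(\<lambda>t. h s t * g t) integrable_on {0..\<tau>}"
      by (intro integrable_continuous_real continuous_intros g)
    ultimately show ?thesis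
      by (simp add: r.kop_def r_def left_diff_distrib integral_diff)
  qed
  \<comment> \<open>By orthonormality only \<open>j = k\<close> contributes, so the sums are
    constant from \<open>m = k\<close> on. Thus \<open>h\<close> and \<open>c\<close> act alike on
    \<open>phi k\<close>.\<close>
  have kop_phi: "r.kop (phi k) s = 0" if k: "1 \<le> k" and s: "s \<in> {0..\<tau>}" for k s
  proof -
    have "\<forall>\<^sub>F m in sequentially. (\<Sum>j=1..m. lam j * phi j s * l2_inner 0 \<tau> (phi j) (phi k)) = lam k * phi k s"
      using eventually_ge_at_top[of k]
    proof eventually_elim
      case (elim m)
      have "(\<Sum>j=1..m. lam j * phi j s * l2_inner 0 \<tau> (phi j) (phi k))
          = (\<Sum>j=1..m. if j = k then lam k * phi k s else 0)"
        using k by (intro sum.cong) (auto simp: orth)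
      then show ?case using elim k by simp
    qed
    then have "(\<lambda>m. \<Sum>j=1..m. lam j * phi j s * l2_inner 0 \<tau> (phi j) (phi k)) \<longlonglongrightarrow> lam k * phi k s"
      by (rule tendsto_eventually)
    then have "integral {0..\<tau>} (\<lambda>t. h s t * phi k t) = lam k * phi k s"
      using LIMSEQ_unique hint[OF phic[OF k] s] by blast
    then show ?thesis
      using kop_eq[OF phic[OF k] s] eigk[OF k s] by simp
  qed
  have "r t0 t0 = 0"
  proof (rule ccontr)
    assume "r t0 t0 \<noteq> 0"
    then obtain \<mu> f where \<mu>: "\<mu> \<noteq> 0" and f: "continuous_on {0..\<tau>} f"
      and fnz: "\<exists>t\<in>{0..\<tau>}. f t \<noteq> 0" and kf: "\<And>s. s \<in> {0..\<tau>} \<Longrightarrow> r.kop f s = \<mu> * f s"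
      using r.nonzero_eigenvalue_exists[OF t0 t0] by blast
    have fphi: "l2_inner 0 \<tau> (phi k) f = 0" if k: "1 \<le> k" for k
    proof -
      have "\<mu> * l2_inner 0 \<tau> (phi k) f = l2_inner 0 \<tau> (phi k) (r.kop f)"
        unfolding l2_inner_scale_right[symmetric] unfolding l2_inner_def
        by (intro integral_cong) (simp add: kf)
      also have "\<dots> = l2_inner 0 \<tau> (r.kop (phi k)) f"
        by (rule r.kop_adjoint[OF phic[OF k] f])
      also have "\<dots> = integral {0..\<tau>} (\<lambda>_. 0)"
        unfolding l2_inner_def by (intro integral_cong) (simp add: kop_phi[OF k])
      finally show ?thesis using \<mu> by simp
    qed
    \<comment> \<open>As \<open>f\<close> is orthogonal to every \<open>phi k\<close>, the operator
      of \<open>h\<close> sends it to 0, and the eigenvalue equation for \<open>r\<close> becomes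
      one for \<open>c\<close>.\<close>
    have "integral {0..\<tau>} (\<lambda>t. c s t * f t) = \<mu> * f s" if s: "s \<in> {0..\<tau>}" for s
    proof -
      have "(\<lambda>m. \<Sum>k=1..m. lam k * phi k s * l2_inner 0 \<tau> (phi k) f) = (\<lambda>m. 0)"
        by (intro ext sum.neutral) (simp add: fphi)
      then have "integral {0..\<tau>} (\<lambda>t. h s t * f t) = 0"
        using hint[OF f s] by (simp add: LIMSEQ_const_iff)
      then show ?thesis using kop_eq[OF f s] kf[OF s] by simp
    qed
    moreover have "(LBINT t:{0..\<tau>}. c s t * f t) = integral {0..\<tau>} (\<lambda>t. c s t * f t)"
      if s: "s \<in> {0..\<tau>}" for s
      by (intro set_lebesgue_integral_continuous_eq continuous_intros csec f s)
    ultimately have "eigenfunction \<tau> c \<mu> f"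
      unfolding eigenfunction_def using f fnz by simp
    then have "\<exists>J a. finite J \<and> J \<subseteq> {k. 1 \<le> k \<and> lam k = \<mu>} \<and>
        (\<forall>s\<in>{0..\<tau>}. f s = (\<Sum>k\<in>J. a k * phi k s))"
      using eig[unfolded eigensystem_def, THEN conjunct2, THEN conjunct2, THEN conjunct2] \<mu> by simp
    then obtain J a where J: "finite J" "J \<subseteq> {k. 1 \<le> k \<and> lam k = \<mu>}"
      and fs: "\<And>s. s \<in> {0..\<tau>} \<Longrightarrow> f s = (\<Sum>k\<in>J. a k * phi k s)"
      by (elim exE conjE) (rule that, auto)
    \<comment> \<open>Pairing the finite expansion of \<open>f\<close> with \<open>f\<close> itself
      reduces its norm to inner products already known to vanish.\<close>
    have "f t * f t = (\<Sum>k\<in>J. a k * (phi k t * f t))" if t: "t \<in> {0..\<tau>}" for t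
    proof -
      have "f t * f t = (\<Sum>k\<in>J. a k * phi k t) * f t"
        by (simp only: fs[OF t, symmetric])
      then show ?thesis by (simp add: sum_distrib_right mult.assoc)
    qed
    then have "l2_inner 0 \<tau> f f = integral {0..\<tau>} (\<lambda>t. \<Sum>k\<in>J. a k * (phi k t * f t))"
      unfolding l2_inner_def by (intro integral_cong)
    also have "\<dots> = (\<Sum>k\<in>J. integral {0..\<tau>} (\<lambda>t. a k * (phi k t * f t)))"
      using J by (intro integral_sum integrable_continuous_real continuous_intros f phic) auto
    also have "\<dots> = (\<Sum>k\<in>J. a k * l2_inner 0 \<tau> (phi k) f)"
      by (simp add: l2_inner_def)
    also have "\<dots> = 0"
      using J(2) fphi by (intro sum.neutral) auto
    finally show False
      using l2_inner_self_eq_0_iff[OF f \<tau>] fnz by auto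
  qed
  moreover have "p m t0 t0 = (\<Sum>k=1..m. lam k * (phi k t0)\<^sup>2)" for m
    by (simp add: p_def power2_eq_square mult.assoc)
  ultimately show ?thesis
    using plim[OF t0 t0] by (simp add: r_def)
qed

subsection \<open>Chaining\<close>

definition dyadic_point :: "real \<Rightarrow> nat \<Rightarrow> nat \<Rightarrow> real" where
  "dyadic_point \<tau> l j = real j * \<tau> / 2 ^ l"

lemma dyadic_point_mem:
  assumes "0 < \<tau>" "j \<le> 2 ^ l"
  shows "dyadic_point \<tau> l j \<in> {0..\<tau>}"
proof -
  have "real j \<le> 2 ^ l" using assms(2) by (metis of_nat_le_iff of_nat_numeral of_nat_power)
  then show ?thesis using assms(1) by (simp add: dyadic_point_def divide_le_eq mult.commute)
qed

text \<open>Dyadic points of levels at least \<open>p\<close> are dense, and a weak inequality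
  survives the limit. This reduces statements about all times to countably many.\<close>

lemma le_of_le_dyadic:
  fixes f :: "real \<Rightarrow> real"
  assumes \<tau>: "0 < \<tau>" and f: "continuous_on {0..\<tau>} f"
    and le: "\<And>l j. p \<le> l \<Longrightarrow> j \<le> 2 ^ l \<Longrightarrow> f (dyadic_point \<tau> l j) \<le> e"
    and t: "t \<in> {0..\<tau>}"
  shows "f t \<le> e"
proof -
  \<comment> \<open>The index of the last dyadic point of level \<open>l\<close> not exceeding
    \<open>t\<close>; its distance from \<open>t\<close> is less than
    \<open>\<tau> / 2 ^ l\<close>.\<close>
  define j where "j l = nat \<lfloor>t * 2 ^ l / \<tau>\<rfloor>" for l :: nat
  have jle: "real (j l) \<le> t * 2 ^ l / \<tau>" and jgt: "t * 2 ^ l / \<tau> < real (j l) + 1" for l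
    using t \<tau> by (simp_all add: j_def)
  have j2: "j l \<le> 2 ^ l" for l
  proof -
    have "t * 2 ^ l / \<tau> \<le> 2 ^ l"
      using t \<tau> by (simp add: divide_le_eq mult.commute)
    then have "real (j l) \<le> real (2 ^ l)" using jle[of l] by (simp only: of_nat_power of_nat_numeral)
    then show ?thesis by (rule of_nat_le_iff[THEN iffD1])
  qed
  have "(\<lambda>l. dyadic_point \<tau> l (j l)) \<longlonglongrightarrow> t"
  proof (rule tendsto_sandwich[OF always_eventually always_eventually])
    show "\<forall>l. t - \<tau> * (1 / 2) ^ l \<le> dyadic_point \<tau> l (j l)"
    proof
      fix l
      have "t * 2 ^ l \<le> (real (j l) + 1) * \<tau>"
        using jgt[of l] \<tau> by (simp add: divide_less_eq)
      then have "t \<le> (real (j l) + 1) * \<tau> / 2 ^ l"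
        by (simp add: pos_le_divide_eq)
      also have "\<dots> = dyadic_point \<tau> l (j l) + \<tau> * (1 / 2) ^ l"
        by (simp add: dyadic_point_def distrib_right add_divide_distrib power_divide)
      finally show "t - \<tau> * (1 / 2) ^ l \<le> dyadic_point \<tau> l (j l)"
        by simp
    qed
    show "\<forall>l. dyadic_point \<tau> l (j l) \<le> t"
      using jle \<tau> by (simp add: dyadic_point_def divide_le_eq pos_le_divide_eq)
    have "(\<lambda>l. t - \<tau> * (1 / 2) ^ l) \<longlonglongrightarrow> t - \<tau> * 0"
      by (intro tendsto_intros LIMSEQ_realpow_zero) auto
    then show "(\<lambda>l. t - \<tau> * (1 / 2) ^ l) \<longlonglongrightarrow> t" by simp
  qed simp
  then have "(\<lambda>l. f (dyadic_point \<tau> l (j l))) \<longlonglongrightarrow> f t"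
    using dyadic_point_mem[OF \<tau> j2]
    by (intro continuous_on_tendsto_compose[OF f _ t]) (auto intro: always_eventually)
  then show ?thesis
    by (rule tendsto_upperbound)
      (auto intro!: eventually_mono[OF eventually_ge_at_top[of p]] le j2)
qed

text \<open>Points with even index already occur on the previous, coarser level, and a point with
  odd index is one step from its left neighbour, which does. Each level thus adds at most one jump.
  The sum starts at 0 instead of \<open>p + 1\<close>: the extra terms are nonnegative, and one
  estimate of the sum then serves every \<open>p\<close>.\<close>

lemma dyadic_chain_bound:
  fixes f :: "real \<Rightarrow> real" and a :: "nat \<Rightarrow> real"
  assumes base: "\<And>j. j \<le> 2 ^ p \<Longrightarrow> \<bar>f (dyadic_point \<tau> p j)\<bar> \<le> e"
    and step: "\<And>l j. p < l \<Longrightarrow> j < 2 ^ l \<Longrightarrow>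
      \<bar>f (dyadic_point \<tau> l (Suc j)) - f (dyadic_point \<tau> l j)\<bar> \<le> a l"
    and a: "\<And>l. 0 \<le> a l" and "p \<le> l" "j \<le> 2 ^ l"
  shows "\<bar>f (dyadic_point \<tau> l j)\<bar> \<le> e + (\<Sum>i\<le>l. a i)"
  using \<open>p \<le> l\<close> \<open>j \<le> 2 ^ l\<close>
proof (induction l arbitrary: j rule: dec_induct)
  case base
  then show ?case using assms(1)[of j] sum_nonneg[of "{..p}" a] a by fastforce
next
  case (step l)
  have half: "dyadic_point \<tau> (Suc l) (2 * i) = dyadic_point \<tau> l i" for i
    by (simp add: dyadic_point_def)
  show ?case
  proof (cases "even j")
    case True
    then obtain i where i: "j = 2 * i" by blast
    with step.IH[of i] step.prems a[of "Suc l"] show ?thesis by (simp add: half)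
  next
    case False
    then obtain i where i: "j = Suc (2 * i)" by (auto elim: oddE)
    have "\<bar>f (dyadic_point \<tau> l i)\<bar> \<le> e + (\<Sum>i\<le>l. a i)"
      using step.prems i by (intro step.IH) simp
    moreover have "\<bar>f (dyadic_point \<tau> (Suc l) (Suc (2 * i))) - f (dyadic_point \<tau> (Suc l) (2 * i))\<bar> \<le> a (Suc l)"
      using step.prems step.hyps i by (intro assms(2)) auto
    ultimately show ?thesis
      unfolding i half by simp
  qed
qed

text \<open>
  Chaining over dyadic partitions. A jump larger than \<open>a l = (\<epsilon>/8) (3/4)\<^sup>l\<close> at level \<open>l\<close> has probability
  at most \<open>D (8/9)\<^sup>l\<close>, by a union bound over the \<open>2\<^sup>l\<close> intervals, while the \<open>a l\<close> add up to at
  most \<open>\<epsilon>/2\<close>.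
\<close>

theorem chaining_tendsto_zero:
  fixes R :: "nat \<Rightarrow> real \<Rightarrow> 'w \<Rightarrow> real"
  assumes "prob_space M" and \<tau>: "0 < \<tau>"
    and meas: "\<And>m t. t \<in> {0..\<tau>} \<Longrightarrow> R m t \<in> borel_measurable M"
    and sq: "\<And>m t. t \<in> {0..\<tau>} \<Longrightarrow> integrable M (\<lambda>\<omega>. (R m t \<omega>)\<^sup>2)"
    and cont: "\<And>m \<omega>. \<omega> \<in> space M \<Longrightarrow> continuous_on {0..\<tau>} (\<lambda>t. R m t \<omega>)"
    and incr: "\<And>m s t. s \<in> {0..\<tau>} \<Longrightarrow> t \<in> {0..\<tau>} \<Longrightarrow>
      (LINT \<omega>|M. (R m t \<omega> - R m s \<omega>)\<^sup>2) \<le> K * (t - s)\<^sup>2"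
    and lim: "\<And>t. t \<in> {0..\<tau>} \<Longrightarrow> (\<lambda>m. LINT \<omega>|M. (R m t \<omega>)\<^sup>2) \<longlonglongrightarrow> 0"
    and \<epsilon>: "0 < \<epsilon>"
  shows "(\<lambda>m. measure M {\<omega>\<in>space M. \<exists>t\<in>{0..\<tau>}. \<epsilon> < \<bar>R m t \<omega>\<bar>}) \<longlonglongrightarrow> 0"
proof -
  interpret prob_space M by fact
  let ?q = "dyadic_point \<tau>"
  \<comment> \<open>A ratio q must satisfy q < 1 for summability, and 1 / (2 q^2) < 1 for the union
    bound over \<open>2 ^ l\<close> jumps; 3/4 does both. Its powers sum to 4, hence the factor
    \<open>\<epsilon> / 8\<close>.\<close>
  define a where "a l = \<epsilon> / 8 * (3 / 4) ^ l" for l :: nat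
  have a0: "0 < a l" for l using \<epsilon> by (simp add: a_def)
  have asum: "(\<Sum>i\<le>l. a i) \<le> \<epsilon> / 2" for l
  proof -
    have "(\<Sum>i\<le>l. a i) = \<epsilon> / 8 * (\<Sum>i<Suc l. (3 / 4) ^ i)"
      by (simp add: a_def sum_distrib_left lessThan_Suc_atMost)
    also have "(\<Sum>i<Suc l. (3 / 4 :: real) ^ i) = 4 * (1 - (3 / 4) ^ Suc l)"
      by (subst geometric_sum) (auto simp: field_simps)
    also have "\<epsilon> / 8 * (4 * (1 - (3 / 4) ^ Suc l)) \<le> \<epsilon> / 8 * (4 * 1)"
      using \<epsilon> by (intro mult_left_mono) auto
    finally show ?thesis by simp
  qed
  define A where "A p m = (\<Union>j\<in>{..2 ^ p}. {\<omega>\<in>space M. \<epsilon> / 2 \<le> \<bar>R m (?q p j) \<omega>\<bar>})" for p m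
  define B where "B l m = (\<Union>j\<in>{..<2 ^ l}. {\<omega>\<in>space M. a l \<le> \<bar>R m (?q l (Suc j)) \<omega> - R m (?q l j) \<omega>\<bar>})"
    for l m
  define G where "G p m = (\<Sum>j\<le>2 ^ p. (LINT \<omega>|M. (R m (?q p j) \<omega>)\<^sup>2) / (\<epsilon> / 2)\<^sup>2)" for p :: nat and m
  \<comment> \<open>This is K \<tau>^2 / (a 0)^2, the Chebyshev bound for a jump across the whole
    interval.\<close>
  define D where "D = 64 * K * \<tau>\<^sup>2 / \<epsilon>\<^sup>2"
  have measq[measurable]: "R m (?q l j) \<in> borel_measurable M" if "j \<le> 2 ^ l" for m l j
    by (intro meas dyadic_point_mem that \<tau>)
  have setsA: "{\<omega>\<in>space M. \<epsilon> / 2 \<le> \<bar>R m (?q p j) \<omega>\<bar>} \<in> sets M" if "j \<le> 2 ^ p" for p m j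
    using measq[OF that] by measurable
  have setsB: "{\<omega>\<in>space M. a l \<le> \<bar>R m (?q l (Suc j)) \<omega> - R m (?q l j) \<omega>\<bar>} \<in> sets M"
    if "j < 2 ^ l" for l m j
    using measq[of "Suc j" l] measq[of j l] that by simp
  have A: "A p m \<in> sets M" and B: "B l m \<in> sets M" for p l m
    unfolding A_def B_def by (auto intro!: sets.finite_UN setsA setsB)
  have mA: "measure M (A p m) \<le> G p m" for p m
  proof -
    have "measure M (A p m) \<le> (\<Sum>j\<le>2 ^ p. measure M {\<omega>\<in>space M. \<epsilon> / 2 \<le> \<bar>R m (?q p j) \<omega>\<bar>})"
      unfolding A_def by (intro finite_measure_subadditive_finite) (auto intro: setsA)
    also have "\<dots> \<le> G p m"
      unfolding G_def
      using \<epsilon> \<tau> by (intro sum_mono second_moment_method sq meas dyadic_point_mem) auto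
    finally show ?thesis .
  qed
  have mB: "measure M (B l m) \<le> D * (8 / 9) ^ l" for l m
  proof -
    have 1: "measure M {\<omega>\<in>space M. a l \<le> \<bar>R m (?q l (Suc j)) \<omega> - R m (?q l j) \<omega>\<bar>}
        \<le> K * (\<tau> / 2 ^ l)\<^sup>2 / (a l)\<^sup>2" if j: "j < 2 ^ l" for j
    proof -
      have m: "?q l (Suc j) \<in> {0..\<tau>}" "?q l j \<in> {0..\<tau>}"
        using j by (auto intro!: dyadic_point_mem \<tau> simp del: atLeastAtMost_iff)
      have "integrable M (\<lambda>\<omega>. (R m (?q l (Suc j)) \<omega> - R m (?q l j) \<omega>)\<^sup>2)"
      proof (rule Bochner_Integration.integrable_bound)
        show "integrable M (\<lambda>\<omega>. 2 * (R m (?q l (Suc j)) \<omega>)\<^sup>2 + 2 * (R m (?q l j) \<omega>)\<^sup>2)"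
          using m by (intro Bochner_Integration.integrable_add integrable_mult_right sq)
        have "(x - y)\<^sup>2 \<le> 2 * x\<^sup>2 + 2 * y\<^sup>2" for x y :: real
          using zero_le_power2[of "x + y"] unfolding power2_sum power2_diff by linarith
        then show "AE \<omega> in M. norm ((R m (?q l (Suc j)) \<omega> - R m (?q l j) \<omega>)\<^sup>2)
            \<le> norm (2 * (R m (?q l (Suc j)) \<omega>)\<^sup>2 + 2 * (R m (?q l j) \<omega>)\<^sup>2)"
          by simp
      qed (use meas[OF m(1)] meas[OF m(2)] in measurable)
      then have "measure M {\<omega>\<in>space M. a l \<le> \<bar>R m (?q l (Suc j)) \<omega> - R m (?q l j) \<omega>\<bar>}
          \<le> (LINT \<omega>|M. (R m (?q l (Suc j)) \<omega> - R m (?q l j) \<omega>)\<^sup>2) / (a l)\<^sup>2"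
        by (intro second_moment_method a0 borel_measurable_diff meas m)
      also have "\<dots> \<le> K * (?q l (Suc j) - ?q l j)\<^sup>2 / (a l)\<^sup>2"
        by (intro divide_right_mono incr m) auto
      also have "?q l (Suc j) - ?q l j = \<tau> / 2 ^ l"
        by (simp add: dyadic_point_def field_simps)
      finally show ?thesis .
    qed
    have "measure M (B l m)
        \<le> (\<Sum>j<2 ^ l. measure M {\<omega>\<in>space M. a l \<le> \<bar>R m (?q l (Suc j)) \<omega> - R m (?q l j) \<omega>\<bar>})"
      unfolding B_def by (intro finite_measure_subadditive_finite) (auto intro: setsB)
    also have "\<dots> \<le> (\<Sum>j<(2::nat) ^ l. K * (\<tau> / 2 ^ l)\<^sup>2 / (a l)\<^sup>2)"
      by (intro sum_mono 1) auto
    also have "\<dots> = D * (2 ^ l * (1 / 2 ^ l)\<^sup>2 / ((3 / 4) ^ l)\<^sup>2)"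
      using \<epsilon> by (simp add: a_def D_def power_mult_distrib power_divide mult_ac)
    also have "2 ^ l * (1 / 2 ^ l)\<^sup>2 / ((3 / 4) ^ l)\<^sup>2 = (2 * (1 / 2)\<^sup>2 / (3 / 4)\<^sup>2 :: real) ^ l"
      by (simp only: power_mult_distrib power_divide power2_eq_square power_one)
    also have "(2 * (1 / 2)\<^sup>2 / (3 / 4)\<^sup>2 :: real) = 8 / 9"
      by (simp add: power2_eq_square)
    finally show ?thesis .
  qed
  \<comment> \<open>The factor 9 sums the geometric series with ratio 8/9, taken from level
    \<open>Suc p\<close> on. Off the exceptional events the values at level \<open>p\<close> are at
    most half of \<open>\<epsilon>\<close>, and all later jumps together use at most the other
    half.\<close>
  have main: "measure M {\<omega>\<in>space M. \<exists>t\<in>{0..\<tau>}. \<epsilon> < \<bar>R m t \<omega>\<bar>} \<le> G p m + 9 * D * (8 / 9) ^ Suc p"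
    for p m
  proof -
    have sub: "{\<omega>\<in>space M. \<exists>t\<in>{0..\<tau>}. \<epsilon> < \<bar>R m t \<omega>\<bar>} \<subseteq> A p m \<union> (\<Union>i. B (Suc p + i) m)"
    proof (rule subsetI, rule ccontr)
      fix \<omega> assume \<omega>: "\<omega> \<in> {\<omega>\<in>space M. \<exists>t\<in>{0..\<tau>}. \<epsilon> < \<bar>R m t \<omega>\<bar>}"
        and n: "\<omega> \<notin> A p m \<union> (\<Union>i. B (Suc p + i) m)"
      have 1: "\<bar>R m (?q p j) \<omega>\<bar> \<le> \<epsilon> / 2" if "j \<le> 2 ^ p" for j
        using n \<omega> that by (force simp: A_def)
      have 2: "\<bar>R m (?q l (Suc j)) \<omega> - R m (?q l j) \<omega>\<bar> \<le> a l" if "p < l" "j < 2 ^ l" for l j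
      proof -
        have "\<omega> \<notin> B (Suc p + (l - Suc p)) m" using n by blast
        then show ?thesis using \<omega> that by (force simp: B_def)
      qed
      have "\<bar>R m t \<omega>\<bar> \<le> \<epsilon>" if t: "t \<in> {0..\<tau>}" for t
      proof (rule le_of_le_dyadic[OF \<tau> _ _ t])
        show "continuous_on {0..\<tau>} (\<lambda>t. \<bar>R m t \<omega>\<bar>)"
          using \<omega> by (intro continuous_intros cont) auto
        show "\<bar>R m (?q l j) \<omega>\<bar> \<le> \<epsilon>" if "p \<le> l" "j \<le> 2 ^ l" for l j
          using dyadic_chain_bound[of p "\<lambda>t. R m t \<omega>" \<tau> "\<epsilon> / 2" a l j] 1 2 a0 that asum[of l]
          by (fastforce intro: less_imp_le)
      qed
      then show False using \<omega> by fastforce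
    qed
    have sums: "(\<lambda>i. D * (8 / 9) ^ (Suc p + i)) sums (9 * D * (8 / 9) ^ Suc p)"
      using sums_mult[OF geometric_sums[of "8 / 9 :: real"], of "D * (8 / 9) ^ Suc p"]
      by (simp add: power_add mult.assoc mult.commute mult.left_commute)
    have summ: "summable (\<lambda>i. measure M (B (Suc p + i) m))"
      using mB[of "Suc p + _" m]
      by (intro summable_comparison_test'[OF sums_summable[OF sums], of 0]) (simp del: power_Suc add_Suc)
    have "measure M {\<omega>\<in>space M. \<exists>t\<in>{0..\<tau>}. \<epsilon> < \<bar>R m t \<omega>\<bar>} \<le> measure M (A p m \<union> (\<Union>i. B (Suc p + i) m))"
      using A B by (intro finite_measure_mono sub) auto
    also have "\<dots> \<le> measure M (A p m) + measure M (\<Union>i. B (Suc p + i) m)"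
      using A B by (intro measure_Un_le) auto
    also have "measure M (\<Union>i. B (Suc p + i) m) \<le> (\<Sum>i. measure M (B (Suc p + i) m))"
      using B summ by (intro finite_measure_subadditive_countably) auto
    also have "\<dots> \<le> 9 * D * (8 / 9) ^ Suc p"
      unfolding sums_unique[OF sums]
      by (intro suminf_le summ sums_summable[OF sums] mB)
    finally show ?thesis using mA[of p m] by linarith
  qed
  have Glim: "(\<lambda>m. G p m) \<longlonglongrightarrow> 0" for p
    unfolding G_def by (intro tendsto_null_sum tendsto_divide_zero lim dyadic_point_mem \<tau>) auto
  show ?thesis
  proof (rule LIMSEQ_I)
    \<comment> \<open>The tail does not depend on \<open>m\<close>, so \<open>p\<close> is fixed
      before \<open>m\<close>; after that \<open>G p m\<close> concerns finitely many times only,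
      and pointwise mean square convergence suffices.\<close>
    fix \<delta> :: real assume \<delta>: "0 < \<delta>"
    have "(\<lambda>p. 9 * D * (8 / 9) ^ Suc p) \<longlonglongrightarrow> 0"
      by (intro tendsto_mult_right_zero LIMSEQ_Suc[OF LIMSEQ_realpow_zero]) auto
    then have "\<forall>\<^sub>F p in sequentially. 9 * D * (8 / 9) ^ Suc p < \<delta> / 2"
      by (rule order_tendstoD) (use \<delta> in simp)
    then obtain p where p: "9 * D * (8 / 9) ^ Suc p < \<delta> / 2"
      by (auto simp: eventually_sequentially)
    have "\<forall>\<^sub>F m in sequentially. G p m < \<delta> / 2"
      by (rule order_tendstoD[OF Glim]) (use \<delta> in simp)
    then obtain N where N: "\<And>m. N \<le> m \<Longrightarrow> G p m < \<delta> / 2"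
      by (auto simp: eventually_sequentially)
    show "\<exists>N. \<forall>m\<ge>N. norm (measure M {\<omega>\<in>space M. \<exists>t\<in>{0..\<tau>}. \<epsilon> < \<bar>R m t \<omega>\<bar>} - 0) < \<delta>"
    proof (intro exI allI impI)
      fix m assume "N \<le> m"
      then show "norm (measure M {\<omega>\<in>space M. \<exists>t\<in>{0..\<tau>}. \<epsilon> < \<bar>R m t \<omega>\<bar>} - 0) < \<delta>"
        using main[of m p] N[of m] p by simp
    qed
  qed
qed

subsection \<open>Second moments of the residual\<close>

text \<open>The mean value theorem in the first variable and then in the second turns this second
  difference into \<open>g12 x y * (t - s)\<^sup>2\<close>, and \<open>g12\<close> is bounded on the
  compact square. For a correlation function the difference is E (X t - X s)^2.\<close>

lemma mixed_difference_bound: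
  assumes "continuous_second_partials \<tau> c"
  obtains K where "\<And>s t. s \<in> {0..\<tau>} \<Longrightarrow> t \<in> {0..\<tau>} \<Longrightarrow>
    c t t - c s t - c t s + c s s \<le> K * (t - s)\<^sup>2"
proof -
  obtain g1 g12 where g1: "has_partial_fst \<tau> c g1" and g12: "has_partial_snd \<tau> g1 g12"
    and cont: "continuous_on ({0..\<tau>} \<times> {0..\<tau>}) (\<lambda>(s, t). g12 s t)"
    using assms unfolding continuous_second_partials_def by blast
  obtain K where "\<And>p. p \<in> {0..\<tau>} \<times> {0..\<tau>} \<Longrightarrow> \<bar>case p of (s, t) \<Rightarrow> g12 s t\<bar> \<le> K"
    using continuous_on_compact_abs_bound[OF compact_Times[OF compact_Icc compact_Icc] cont] by metis
  then have K: "\<bar>g12 s t\<bar> \<le> K" if "s \<in> {0..\<tau>}" "t \<in> {0..\<tau>}" for s t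
    using that by fastforce
  have le: "c t t - c s t - c t s + c s s \<le> K * (t - s)\<^sup>2"
    if s: "s \<in> {0..\<tau>}" and t: "t \<in> {0..\<tau>}" and st: "s \<le> t" for s t
  proof -
    have sub: "{s..t} \<subseteq> {0..\<tau>}" using s t by auto
    have "\<exists>x\<in>{s..t}. (c t t - c t s) - (c s t - c s s) = (\<lambda>h. h * (g1 x t - g1 x s)) (t - s)"
    proof (rule mvt_very_simple[OF st, of "\<lambda>u. c u t - c u s"])
      fix x assume "s \<le> x" "x \<le> t"
      then have x: "x \<in> {0..\<tau>}" using sub by auto
      have "((\<lambda>u. c u t - c u s) has_real_derivative g1 x t - g1 x s) (at x within {0..\<tau>})"
        using g1 x s t unfolding has_partial_fst_def by (intro DERIV_diff) auto
      then have "((\<lambda>u. c u t - c u s) has_real_derivative g1 x t - g1 x s) (at x within {s..t})"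
        by (rule DERIV_subset[OF _ sub])
      then show "((\<lambda>u. c u t - c u s) has_derivative (\<lambda>h. h * (g1 x t - g1 x s))) (at x within {s..t})"
        by (simp add: has_field_derivative_def mult.commute[of _ "g1 x t - g1 x s"])
    qed
    then obtain x where x: "x \<in> {s..t}"
      and e1: "(c t t - c t s) - (c s t - c s s) = (t - s) * (g1 x t - g1 x s)" by auto
    have x': "x \<in> {0..\<tau>}" using x sub by auto
    have "\<exists>y\<in>{s..t}. g1 x t - g1 x s = (\<lambda>h. h * g12 x y) (t - s)"
    proof (rule mvt_very_simple[OF st])
      fix y assume "s \<le> y" "y \<le> t"
      then have y: "y \<in> {0..\<tau>}" using sub by auto
      have "(g1 x has_real_derivative g12 x y) (at y within {0..\<tau>})"
        using g12 x' y unfolding has_partial_snd_def by auto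
      then have "(g1 x has_real_derivative g12 x y) (at y within {s..t})"
        by (rule DERIV_subset[OF _ sub])
      then show "(g1 x has_derivative (\<lambda>h. h * g12 x y)) (at y within {s..t})"
        by (simp add: has_field_derivative_def mult.commute[of _ "g12 x y"])
    qed
    then obtain y where y: "y \<in> {s..t}" and e2: "g1 x t - g1 x s = (t - s) * g12 x y" by auto
    have "c t t - c s t - c t s + c s s = g12 x y * (t - s)\<^sup>2"
      using e1 e2 by (simp add: power2_eq_square algebra_simps)
    also have "\<dots> \<le> K * (t - s)\<^sup>2"
      using K[OF x', of y] y sub by (intro mult_right_mono) auto
    finally show ?thesis .
  qed
  show ?thesis
  proof
    fix s t assume s: "s \<in> {0..\<tau>}" and t: "t \<in> {0..\<tau>}"
    \<comment> \<open>The expression is unchanged when \<open>s\<close> and \<open>t\<close> are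
      exchanged, which settles the case \<open>t < s\<close>.\<close>
    show "c t t - c s t - c t s + c s s \<le> K * (t - s)\<^sup>2"
      using le[OF s t] le[OF t s] by (cases "s \<le> t") (auto simp: power2_commute[of s t])
  qed
qed

section \<open>Joint measurability and Fubini for processes with continuous paths\<close>

lemma integrable_mult_squares:
  fixes f g :: "'a \<Rightarrow> real"
  assumes "f \<in> borel_measurable M" "g \<in> borel_measurable M"
    and "integrable M (\<lambda>x. (f x)\<^sup>2)" "integrable M (\<lambda>x. (g x)\<^sup>2)"
  shows "integrable M (\<lambda>x. f x * g x)"
proof (rule Bochner_Integration.integrable_bound)
  show "integrable M (\<lambda>x. (f x)\<^sup>2 + (g x)\<^sup>2)"
    by (intro Bochner_Integration.integrable_add assms)
  show "AE x in M. norm (f x * g x) \<le> norm ((f x)\<^sup>2 + (g x)\<^sup>2)"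
    using abs_mult_le_sum_squares by simp
qed (intro borel_measurable_times assms)

text \<open>Continuity of the paths turns separate measurability into joint measurability.\<close>

lemma borel_measurable_continuous_paths:
  fixes y :: "real \<Rightarrow> 'w \<Rightarrow> real"
  assumes \<tau>: "0 < \<tau>"
    and meas: "\<And>t. t \<in> {0..\<tau>} \<Longrightarrow> y t \<in> borel_measurable M"
    and cont: "\<And>\<omega>. \<omega> \<in> space M \<Longrightarrow> continuous_on {0..\<tau>} (\<lambda>t. y t \<omega>)"
  shows "(\<lambda>(t, \<omega>). y t \<omega>) \<in> borel_measurable (restrict_space lborel {0..\<tau>} \<Otimes>\<^sub>M M)"
proof -
  let ?L = "restrict_space lborel {0..\<tau>}"
  \<comment> \<open>The step functions below take the time \<open>i / Suc n\<close> for every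
    integer \<open>i\<close>, whereas \<open>y\<close> is known to be measurable only at times in
    the interval; clamping keeps the times inside.\<close>
  define proj where "proj t = max 0 (min \<tau> t)" for t
  have proj: "proj t \<in> {0..\<tau>}" for t using \<tau> by (auto simp: proj_def)
  have proj_cont: "continuous_on UNIV proj"
    unfolding proj_def by (intro continuous_intros)
  define r where "r n t = real_of_int \<lfloor>t * real (Suc n)\<rfloor> / real (Suc n)" for n t
  have fst_meas: "fst \<in> borel_measurable (?L \<Otimes>\<^sub>M M)"
    by (rule measurable_compose[OF measurable_fst])
      (simp add: measurable_restrict_space1 measurable_ident_sets)
  have step: "(\<lambda>p. y (proj (r n (fst p))) (snd p)) \<in> borel_measurable (?L \<Otimes>\<^sub>M M)" for n
    unfolding r_def
  \<comment> \<open>The rounded time takes countably many values, and for a fixed one the function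
    depends on the sample point alone.\<close>
  proof (rule measurable_compose_countable[where g = "\<lambda>p. \<lfloor>fst p * real (Suc n)\<rfloor>"])
    show "(\<lambda>p. y (proj (real_of_int i / real (Suc n))) (snd p)) \<in> borel_measurable (?L \<Otimes>\<^sub>M M)" for i
      by (rule measurable_compose[OF measurable_snd meas[OF proj]])
    have "(\<lambda>p. fst p * real (Suc n)) \<in> borel_measurable (?L \<Otimes>\<^sub>M M)"
      using fst_meas by measurable
    from measurable_compose[OF this measurable_real_floor]
    show "(\<lambda>p. \<lfloor>fst p * real (Suc n)\<rfloor>) \<in> ?L \<Otimes>\<^sub>M M \<rightarrow>\<^sub>M count_space UNIV" .
  qed
  have "(\<lambda>p. y (fst p) (snd p)) \<in> borel_measurable (?L \<Otimes>\<^sub>M M)"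
  proof (rule borel_measurable_LIMSEQ_real[OF _ step])
    fix p assume "p \<in> space (?L \<Otimes>\<^sub>M M)"
    then have t: "fst p \<in> {0..\<tau>}" and \<omega>: "snd p \<in> space M"
      by (auto simp: space_pair_measure space_restrict_space)
    have "(\<lambda>n. r n (fst p)) \<longlonglongrightarrow> fst p"
    proof (rule tendsto_sandwich[OF always_eventually always_eventually])
      show "\<forall>n. fst p - 1 / real (Suc n) \<le> r n (fst p)"
      proof
        fix n
        have "fst p * real (Suc n) - 1 \<le> real_of_int \<lfloor>fst p * real (Suc n)\<rfloor>" by linarith
        then have "(fst p * real (Suc n) - 1) / real (Suc n) \<le> r n (fst p)"
          unfolding r_def by (rule divide_right_mono) simp
        moreover have "(fst p * real (Suc n) - 1) / real (Suc n) = fst p - 1 / real (Suc n)"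
          by (simp add: diff_divide_distrib)
        ultimately show "fst p - 1 / real (Suc n) \<le> r n (fst p)" by simp
      qed
      show "\<forall>n. r n (fst p) \<le> fst p"
        by (simp add: r_def pos_divide_le_eq del: of_nat_Suc)
      show "(\<lambda>n. fst p - 1 / real (Suc n)) \<longlonglongrightarrow> fst p"
        using tendsto_diff[OF tendsto_const LIMSEQ_inverse_real_of_nat, of "fst p"]
        by (simp add: inverse_eq_divide)
    qed simp
    moreover have "continuous_on UNIV (\<lambda>t. y (proj t) (snd p))"
      by (rule continuous_on_compose2[OF cont[OF \<omega>] proj_cont]) (use proj in blast)
    ultimately have "(\<lambda>n. y (proj (r n (fst p))) (snd p)) \<longlonglongrightarrow> y (proj (fst p)) (snd p)"
      by (auto intro: continuous_on_tendsto_compose)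
    then show "(\<lambda>n. y (proj (r n (fst p))) (snd p)) \<longlonglongrightarrow> y (fst p) (snd p)"
      using t by (simp add: proj_def)
  qed
  then show ?thesis by (simp add: split_beta)
qed

locale square_integrable_process = prob_space M for M :: "'w measure" +
  fixes \<tau> :: real and y :: "real \<Rightarrow> 'w \<Rightarrow> real" and c :: "real \<Rightarrow> real \<Rightarrow> real"
  assumes \<tau>: "0 < \<tau>"
    and meas: "t \<in> {0..\<tau>} \<Longrightarrow> y t \<in> borel_measurable M"
    and paths: "\<omega> \<in> space M \<Longrightarrow> continuous_on {0..\<tau>} (\<lambda>t. y t \<omega>)"
    and square: "t \<in> {0..\<tau>} \<Longrightarrow> integrable M (\<lambda>\<omega>. (y t \<omega>)\<^sup>2)"
    and corr: "c s t = (LINT \<omega>|M. y s \<omega> * y t \<omega>)"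
    and cont: "continuous_on ({0..\<tau>} \<times> {0..\<tau>}) (\<lambda>(s, t). c s t)"
begin

text \<open>Lebesgue measure on the interval as a finite measure space of its own, so that its
  product with \<open>M\<close> falls under the Fubini theorems of
  \<open>pair_sigma_finite\<close>.\<close>

abbreviation L :: "real measure" where "L \<equiv> restrict_space lborel {0..\<tau>}"

definition coeff :: "(real \<Rightarrow> real) \<Rightarrow> 'w \<Rightarrow> real" where
  "coeff g \<omega> = (LINT t|L. y t \<omega> * g t)"

lemma space_L [simp]: "space L = {0..\<tau>}"
  by (simp add: space_restrict_space)

lemma set_integral_eq_L: "(LBINT t:{0..\<tau>}. f t) = (LINT t|L. f t)" for f :: "real \<Rightarrow> real"
  by (simp add: integral_restrict_space set_lebesgue_integral_def)

lemma integrable_L: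
  fixes f :: "real \<Rightarrow> real"
  assumes "continuous_on {0..\<tau>} f"
  shows "integrable L f"
  using borel_integrable_atLeastAtMost'[OF assms]
  by (simp add: integrable_restrict_space set_integrable_def)

lemma LINT_L_eq_integral:
  fixes f :: "real \<Rightarrow> real"
  assumes "continuous_on {0..\<tau>} f"
  shows "(LINT t|L. f t) = integral {0..\<tau>} f"
  using set_lebesgue_integral_continuous_eq[OF assms] by (simp add: set_integral_eq_L)

sublocale L: finite_measure L
  by (rule finite_measureI) (use \<tau> in \<open>simp add: emeasure_restrict_space\<close>)

sublocale pair: pair_sigma_finite L M ..

lemma joint_measurable: "(\<lambda>(t, \<omega>). y t \<omega>) \<in> borel_measurable (L \<Otimes>\<^sub>M M)"
  by (intro borel_measurable_continuous_paths \<tau> meas paths)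

text \<open>Integrating over the sample space first gives the diagonal \<open>c t t\<close>, which
  is continuous and so integrable over the interval.\<close>

lemma integrable_joint_square: "integrable (L \<Otimes>\<^sub>M M) (\<lambda>(t, \<omega>). (y t \<omega>)\<^sup>2)"
proof (rule pair.Fubini_integrable)
  show "(\<lambda>(t, \<omega>). (y t \<omega>)\<^sup>2) \<in> borel_measurable (L \<Otimes>\<^sub>M M)"
    using joint_measurable by (simp add: split_beta)
  have "continuous_on {0..\<tau>} (\<lambda>t. c t t)"
    by (rule continuous_on_compose2[OF cont, of _ "\<lambda>t. (t, t)", simplified])
      (auto intro!: continuous_intros)
  then show "integrable L (\<lambda>t. LINT \<omega>|M. norm (case (t, \<omega>) of (t, \<omega>) \<Rightarrow> (y t \<omega>)\<^sup>2))"
    using integrable_L by (simp add: corr power2_eq_square)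
  show "AE t in L. integrable M (\<lambda>\<omega>. case (t, \<omega>) of (t, \<omega>) \<Rightarrow> (y t \<omega>)\<^sup>2)"
    by (intro AE_I2) (simp add: square)
qed

lemma integrable_joint_const:
  assumes "integrable M (f :: 'w \<Rightarrow> real)"
  shows "integrable (L \<Otimes>\<^sub>M M) (\<lambda>(t, \<omega>). f \<omega>)"
proof (rule pair.Fubini_integrable)
  show "(\<lambda>(t, \<omega>). f \<omega>) \<in> borel_measurable (L \<Otimes>\<^sub>M M)"
    using measurable_compose[OF measurable_snd borel_measurable_integrable[OF assms], of L]
    by (simp add: split_beta)
qed (use assms in auto)

text \<open>Domination by B (W^2 + y^2), with B a bound for \<open>g\<close>. It licenses the
  exchange of expectation and time integral in products with a coefficient.\<close>

lemma integrable_joint_product: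
  assumes W: "W \<in> borel_measurable M" "integrable M (\<lambda>\<omega>. (W \<omega>)\<^sup>2)"
    and g: "continuous_on {0..\<tau>} g"
  shows "integrable (L \<Otimes>\<^sub>M M) (\<lambda>(t, \<omega>). W \<omega> * (y t \<omega> * g t))"
proof -
  obtain B where B: "\<And>t. t \<in> {0..\<tau>} \<Longrightarrow> \<bar>g t\<bar> \<le> B"
    using continuous_on_compact_abs_bound[OF compact_Icc g] by metis
  have B0: "0 \<le> B" using B[of 0] \<tau> by auto
  show ?thesis
  proof (rule Bochner_Integration.integrable_bound)
    show "integrable (L \<Otimes>\<^sub>M M) (\<lambda>p. B * ((\<lambda>(t, \<omega>). (W \<omega>)\<^sup>2) p + (\<lambda>(t, \<omega>). (y t \<omega>)\<^sup>2) p))"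
      by (intro integrable_mult_right Bochner_Integration.integrable_add
          integrable_joint_const W integrable_joint_square)
    have "(\<lambda>p. W (snd p)) \<in> borel_measurable (L \<Otimes>\<^sub>M M)"
      by (rule measurable_compose[OF measurable_snd W(1)])
    moreover have "(\<lambda>p. g (fst p)) \<in> borel_measurable (L \<Otimes>\<^sub>M M)"
      by (rule measurable_compose[OF measurable_fst borel_measurable_integrable[OF integrable_L[OF g]]])
    ultimately show "(\<lambda>(t, \<omega>). W \<omega> * (y t \<omega> * g t)) \<in> borel_measurable (L \<Otimes>\<^sub>M M)"
      using joint_measurable by (simp add: split_beta)
    show "AE p in L \<Otimes>\<^sub>M M. norm ((\<lambda>(t, \<omega>). W \<omega> * (y t \<omega> * g t)) p)
        \<le> norm (B * ((\<lambda>(t, \<omega>). (W \<omega>)\<^sup>2) p + (\<lambda>(t, \<omega>). (y t \<omega>)\<^sup>2) p))"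
    proof (intro AE_I2)
      fix p assume p: "p \<in> space (L \<Otimes>\<^sub>M M)"
      obtain t \<omega> where [simp]: "p = (t, \<omega>)" by fastforce
      have t: "t \<in> {0..\<tau>}" using p by (simp add: space_pair_measure)
      have "\<bar>W \<omega> * (y t \<omega> * g t)\<bar> = \<bar>g t\<bar> * \<bar>W \<omega> * y t \<omega>\<bar>"
        by (simp add: abs_mult)
      also have "\<dots> \<le> B * ((W \<omega>)\<^sup>2 + (y t \<omega>)\<^sup>2)"
        by (intro mult_mono B t abs_mult_le_sum_squares B0) auto
      finally show "norm ((\<lambda>(t, \<omega>). W \<omega> * (y t \<omega> * g t)) p)
          \<le> norm (B * ((\<lambda>(t, \<omega>). (W \<omega>)\<^sup>2) p + (\<lambda>(t, \<omega>). (y t \<omega>)\<^sup>2) p))"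
        using B0 by simp
    qed
  qed
qed

lemma coeff_measurable:
  assumes g: "continuous_on {0..\<tau>} g"
  shows "coeff g \<in> borel_measurable M"
proof -
  have "integrable M (\<lambda>\<omega>. LINT t|L. 1 * (y t \<omega> * g t))"
    by (intro pair.integrable_snd[of "\<lambda>t \<omega>. 1 * (y t \<omega> * g t)"] integrable_joint_product g) auto
  then show ?thesis
    using borel_measurable_integrable by (simp add: coeff_def[abs_def])
qed

text \<open>Cauchy--Schwarz along each path bounds the square by the energy of the path times the
  squared norm of \<open>g\<close>; the energy has finite expectation by
  \<open>integrable_joint_square\<close>.\<close>

lemma coeff_square_integrable:
  assumes g: "continuous_on {0..\<tau>} g"
  shows "integrable M (\<lambda>\<omega>. (coeff g \<omega>)\<^sup>2)"
proof (rule Bochner_Integration.integrable_bound)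
  show "integrable M (\<lambda>\<omega>. (LINT t|L. (y t \<omega>)\<^sup>2) * l2_inner 0 \<tau> g g)"
    by (intro integrable_mult_left pair.integrable_snd integrable_joint_square)
  show "(\<lambda>\<omega>. (coeff g \<omega>)\<^sup>2) \<in> borel_measurable M"
    using coeff_measurable[OF g] by measurable
  show "AE \<omega> in M. norm ((coeff g \<omega>)\<^sup>2) \<le> norm ((LINT t|L. (y t \<omega>)\<^sup>2) * l2_inner 0 \<tau> g g)"
  proof (intro AE_I2)
    fix \<omega> assume \<omega>: "\<omega> \<in> space M"
    have "coeff g \<omega> = l2_inner 0 \<tau> (\<lambda>t. y t \<omega>) g"
      unfolding coeff_def l2_inner_def
      by (intro LINT_L_eq_integral continuous_intros paths \<omega> g)
    moreover have "(LINT t|L. (y t \<omega>)\<^sup>2) = l2_inner 0 \<tau> (\<lambda>t. y t \<omega>) (\<lambda>t. y t \<omega>)"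
      unfolding l2_inner_def power2_eq_square
      by (intro LINT_L_eq_integral continuous_intros paths \<omega>)
    ultimately have "(coeff g \<omega>)\<^sup>2 \<le> (LINT t|L. (y t \<omega>)\<^sup>2) * l2_inner 0 \<tau> g g"
      using l2_inner_Cauchy_Schwarz[OF paths[OF \<omega>] g \<tau>] by simp
    then show "norm ((coeff g \<omega>)\<^sup>2) \<le> norm ((LINT t|L. (y t \<omega>)\<^sup>2) * l2_inner 0 \<tau> g g)"
      by simp
  qed
qed

text \<open>Fubini. With \<open>W = y s\<close> the right-hand side is the integral operator of
  \<open>c\<close> applied to \<open>g\<close>; with \<open>W\<close> another coefficient it yields
  the covariance of two coefficients.\<close>

lemma expectation_mult_coeff:
  assumes W: "W \<in> borel_measurable M" "integrable M (\<lambda>\<omega>. (W \<omega>)\<^sup>2)"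
    and g: "continuous_on {0..\<tau>} g"
  shows "(LINT \<omega>|M. W \<omega> * coeff g \<omega>) = (LINT t|L. (LINT \<omega>|M. W \<omega> * y t \<omega>) * g t)"
proof -
  have "(LINT \<omega>|M. W \<omega> * coeff g \<omega>) = (LINT \<omega>|M. LINT t|L. W \<omega> * (y t \<omega> * g t))"
    by (simp add: coeff_def)
  also have "\<dots> = (LINT t|L. LINT \<omega>|M. W \<omega> * (y t \<omega> * g t))"
    by (intro pair.Fubini_integral integrable_joint_product W g)
  also have "\<dots> = (LINT t|L. (LINT \<omega>|M. W \<omega> * y t \<omega>) * g t)"
    by (simp add: mult.assoc[symmetric])
  finally show ?thesis .
qed

end

section \<open>Karhunen--Loeve coefficients and the residual\<close>

locale eigen_process = square_integrable_process M \<tau> y c for M :: "'w measure" and \<tau> y c +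
  fixes lam :: "nat \<Rightarrow> real" and phi :: "nat \<Rightarrow> real \<Rightarrow> real"
  assumes eig: "eigensystem \<tau> c lam phi"
begin

abbreviation Z :: "nat \<Rightarrow> 'w \<Rightarrow> real" where "Z k \<equiv> coeff (phi k)"

lemma phi_cont: "1 \<le> k \<Longrightarrow> continuous_on {0..\<tau>} (phi k)"
  using eig by (auto simp: eigensystem_def eigenfunction_def)

lemma Z_meas: "1 \<le> k \<Longrightarrow> Z k \<in> borel_measurable M"
  by (intro coeff_measurable phi_cont)

lemma Z_square: "1 \<le> k \<Longrightarrow> integrable M (\<lambda>\<omega>. (Z k \<omega>)\<^sup>2)"
  by (intro coeff_square_integrable phi_cont)

lemma expectation_y_Z:
  assumes "s \<in> {0..\<tau>}" "1 \<le> k"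
  shows "(LINT \<omega>|M. y s \<omega> * Z k \<omega>) = lam k * phi k s"
proof -
  have "(LBINT t:{0..\<tau>}. c s t * phi k t) = lam k * phi k s"
    using eig assms by (auto simp: eigensystem_def eigenfunction_def)
  then show ?thesis
    using expectation_mult_coeff[OF meas[OF assms(1)] square[OF assms(1)] phi_cont[OF assms(2)]]
    by (simp add: set_integral_eq_L corr)
qed

lemma expectation_Z_Z:
  assumes "1 \<le> j" "1 \<le> k"
  shows "(LINT \<omega>|M. Z j \<omega> * Z k \<omega>) = (if j = k then lam k else 0)"
proof -
  have "(LINT \<omega>|M. Z j \<omega> * Z k \<omega>) = (LINT t|L. (LINT \<omega>|M. Z j \<omega> * y t \<omega>) * phi k t)"
    by (intro expectation_mult_coeff Z_meas Z_square phi_cont assms)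
  also have "\<dots> = (LINT t|L. lam j * (phi j t * phi k t))"
    using expectation_y_Z assms
    by (intro Bochner_Integration.integral_cong) (auto simp: mult.commute[of "Z j _"])
  also have "\<dots> = lam j * (LBINT t:{0..\<tau>}. phi j t * phi k t)"
    by (simp add: set_integral_eq_L)
  also have "\<dots> = (if j = k then lam k else 0)"
    using eig assms by (auto simp: eigensystem_def)
  finally show ?thesis .
qed

text \<open>The eigenvalue is the second moment of \<open>Z k\<close>. The definition of an
  eigensystem leaves its sign open.\<close>

lemma lam_nonneg: "1 \<le> k \<Longrightarrow> 0 \<le> lam k"
  using expectation_Z_Z[of k k] integral_nonneg_AE[where M = M and f = "\<lambda>\<omega>. Z k \<omega> * Z k \<omega>"] by simp

text \<open>Pythagoras: after expanding the square, the double sum contributes the sum of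
  \<open>lam k * (u k)\<^sup>2\<close> once and the cross terms subtract it twice. \<open>V\<close>
  and \<open>u\<close> are kept general because the values \<open>y t\<close> and the increments
  \<open>y t - y s\<close> both take the role of \<open>V\<close>.\<close>

lemma residual_second_moment:
  assumes V: "V \<in> borel_measurable M" "integrable M (\<lambda>\<omega>. (V \<omega>)\<^sup>2)"
    and VZ: "\<And>k. 1 \<le> k \<Longrightarrow> (LINT \<omega>|M. V \<omega> * Z k \<omega>) = lam k * u k"
  shows "integrable M (\<lambda>\<omega>. ((\<Sum>k=1..m. Z k \<omega> * u k) - V \<omega>)\<^sup>2)"
    and "(LINT \<omega>|M. ((\<Sum>k=1..m. Z k \<omega> * u k) - V \<omega>)\<^sup>2)
      = (LINT \<omega>|M. (V \<omega>)\<^sup>2) - (\<Sum>k=1..m. lam k * (u k)\<^sup>2)"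
proof -
  have eq: "((\<Sum>k=1..m. Z k \<omega> * u k) - V \<omega>)\<^sup>2
      = (\<Sum>j=1..m. \<Sum>k=1..m. u j * u k * (Z j \<omega> * Z k \<omega>))
        - (\<Sum>k=1..m. 2 * u k * (V \<omega> * Z k \<omega>)) + (V \<omega>)\<^sup>2" for \<omega>
    unfolding power2_diff
    by (simp add: power2_eq_square sum_product sum_distrib_left sum_distrib_right mult_ac)
  have ZZ: "integrable M (\<lambda>\<omega>. Z j \<omega> * Z k \<omega>)" if "1 \<le> j" "1 \<le> k" for j k
    by (intro integrable_mult_squares Z_meas Z_square that)
  have VZi: "integrable M (\<lambda>\<omega>. V \<omega> * Z k \<omega>)" if "1 \<le> k" for k
    by (intro integrable_mult_squares Z_meas Z_square V that)
  have i1: "integrable M (\<lambda>\<omega>. \<Sum>j=1..m. \<Sum>k=1..m. u j * u k * (Z j \<omega> * Z k \<omega>))"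
    by (intro Bochner_Integration.integrable_sum integrable_mult_right ZZ) auto
  have i2: "integrable M (\<lambda>\<omega>. \<Sum>k=1..m. 2 * u k * (V \<omega> * Z k \<omega>))"
    by (intro Bochner_Integration.integrable_sum integrable_mult_right VZi) auto
  show "integrable M (\<lambda>\<omega>. ((\<Sum>k=1..m. Z k \<omega> * u k) - V \<omega>)\<^sup>2)"
    unfolding eq by (intro Bochner_Integration.integrable_add Bochner_Integration.integrable_diff i1 i2 V)
  have "(LINT \<omega>|M. (\<Sum>j=1..m. \<Sum>k=1..m. u j * u k * (Z j \<omega> * Z k \<omega>)))
      = (\<Sum>j=1..m. LINT \<omega>|M. (\<Sum>k=1..m. u j * u k * (Z j \<omega> * Z k \<omega>)))"
    by (intro Bochner_Integration.integral_sum Bochner_Integration.integrable_sum integrable_mult_right ZZ) auto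
  also have "\<dots> = (\<Sum>j=1..m. \<Sum>k=1..m. LINT \<omega>|M. u j * u k * (Z j \<omega> * Z k \<omega>))"
    by (intro sum.cong refl Bochner_Integration.integral_sum integrable_mult_right ZZ) auto
  also have "\<dots> = (\<Sum>j=1..m. \<Sum>k=1..m. if j = k then u j * u k * lam k else 0)"
    by (intro sum.cong refl) (auto simp: expectation_Z_Z)
  also have "\<dots> = (\<Sum>k=1..m. lam k * (u k)\<^sup>2)"
    by (simp add: power2_eq_square mult_ac)
  finally have e1: "(LINT \<omega>|M. (\<Sum>j=1..m. \<Sum>k=1..m. u j * u k * (Z j \<omega> * Z k \<omega>))) = (\<Sum>k=1..m. lam k * (u k)\<^sup>2)" .
  have "(LINT \<omega>|M. (\<Sum>k=1..m. 2 * u k * (V \<omega> * Z k \<omega>))) = (\<Sum>k=1..m. LINT \<omega>|M. 2 * u k * (V \<omega> * Z k \<omega>))"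
    by (intro Bochner_Integration.integral_sum integrable_mult_right VZi) auto
  also have "\<dots> = (\<Sum>k=1..m. 2 * (lam k * (u k)\<^sup>2))"
    by (intro sum.cong refl) (auto simp: VZ power2_eq_square)
  finally have e2: "(LINT \<omega>|M. (\<Sum>k=1..m. 2 * u k * (V \<omega> * Z k \<omega>))) = 2 * (\<Sum>k=1..m. lam k * (u k)\<^sup>2)"
    by (simp add: sum_distrib_left)
  show "(LINT \<omega>|M. ((\<Sum>k=1..m. Z k \<omega> * u k) - V \<omega>)\<^sup>2)
      = (LINT \<omega>|M. (V \<omega>)\<^sup>2) - (\<Sum>k=1..m. lam k * (u k)\<^sup>2)"
    unfolding eq
    by (simp only: Bochner_Integration.integral_add Bochner_Integration.integral_diff
        Bochner_Integration.integrable_diff i1 i2 V(2) e1 e2)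
qed

definition residual :: "nat \<Rightarrow> real \<Rightarrow> 'w \<Rightarrow> real" where
  "residual m t \<omega> = (\<Sum>k=1..m. Z k \<omega> * phi k t) - y t \<omega>"

lemma residual_meas: "t \<in> {0..\<tau>} \<Longrightarrow> residual m t \<in> borel_measurable M"
  unfolding residual_def[abs_def]
  by (intro borel_measurable_diff borel_measurable_sum borel_measurable_times Z_meas meas) auto

lemma residual_paths: "\<omega> \<in> space M \<Longrightarrow> continuous_on {0..\<tau>} (\<lambda>t. residual m t \<omega>)"
  unfolding residual_def by (intro continuous_intros phi_cont paths) auto

text \<open>Second moments of the residual and of its increments are nonnegative, which yields the
  Bessel-type bounds that \<open>mercer_diagonal\<close> assumes; its conclusion in turn supplies
  the mean square convergence for chaining.\<close>

theorem residual_tendsto_zero: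
  assumes "continuous_second_partials \<tau> c" "0 < \<epsilon>"
  shows "(\<lambda>m. measure M {\<omega>\<in>space M. \<exists>t\<in>{0..\<tau>}. \<epsilon> < \<bar>residual m t \<omega>\<bar>}) \<longlonglongrightarrow> 0"
proof -
  obtain K where K: "\<And>s t. s \<in> {0..\<tau>} \<Longrightarrow> t \<in> {0..\<tau>} \<Longrightarrow>
      c t t - c s t - c t s + c s s \<le> K * (t - s)\<^sup>2"
    using mixed_difference_bound[OF assms(1)] by metis
  have m2: "integrable M (\<lambda>\<omega>. (residual m t \<omega>)\<^sup>2)"
    "(LINT \<omega>|M. (residual m t \<omega>)\<^sup>2) = c t t - (\<Sum>k=1..m. lam k * (phi k t)\<^sup>2)"
    if t: "t \<in> {0..\<tau>}" for m t
    unfolding residual_def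
    using residual_second_moment[of "y t" "\<lambda>k. phi k t" m, OF meas[OF t] square[OF t] expectation_y_Z[OF t]]
    by (auto simp: corr power2_eq_square)
  have yy: "integrable M (\<lambda>\<omega>. y s \<omega> * y t \<omega>)" if "s \<in> {0..\<tau>}" "t \<in> {0..\<tau>}" for s t
    by (intro integrable_mult_squares meas square that)
  have d2: "(LINT \<omega>|M. (residual m t \<omega> - residual m s \<omega>)\<^sup>2)
      = c t t - c s t - c t s + c s s - (\<Sum>k=1..m. lam k * (phi k t - phi k s)\<^sup>2)"
    if s: "s \<in> {0..\<tau>}" and t: "t \<in> {0..\<tau>}" for m s t
  proof -
    have sq: "(y t \<omega> - y s \<omega>)\<^sup>2 = y t \<omega> * y t \<omega> - y s \<omega> * y t \<omega> - y t \<omega> * y s \<omega> + y s \<omega> * y s \<omega>" for \<omega>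
      by (simp add: power2_eq_square algebra_simps)
    have i: "integrable M (\<lambda>\<omega>. (y t \<omega> - y s \<omega>)\<^sup>2)"
      unfolding sq by (intro Bochner_Integration.integrable_add Bochner_Integration.integrable_diff yy s t)
    have e: "(LINT \<omega>|M. (y t \<omega> - y s \<omega>)\<^sup>2) = c t t - c s t - c t s + c s s"
      by (simp only: sq corr Bochner_Integration.integral_add Bochner_Integration.integral_diff
          Bochner_Integration.integrable_add Bochner_Integration.integrable_diff yy s t)
    have z: "(LINT \<omega>|M. (y t \<omega> - y s \<omega>) * Z k \<omega>) = lam k * (phi k t - phi k s)" if k: "1 \<le> k" for k
    proof -
      have "integrable M (\<lambda>\<omega>. y t \<omega> * Z k \<omega>)" "integrable M (\<lambda>\<omega>. y s \<omega> * Z k \<omega>)"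
        by (intro integrable_mult_squares meas square Z_meas Z_square k s t)+
      then show ?thesis
        by (simp add: left_diff_distrib right_diff_distrib expectation_y_Z[OF s k] expectation_y_Z[OF t k])
    qed
    have "residual m t \<omega> - residual m s \<omega> = (\<Sum>k=1..m. Z k \<omega> * (phi k t - phi k s)) - (y t \<omega> - y s \<omega>)" for \<omega>
      by (simp add: residual_def right_diff_distrib sum_subtractf)
    then show ?thesis
      using residual_second_moment(2)[of "\<lambda>\<omega>. y t \<omega> - y s \<omega>" "\<lambda>k. phi k t - phi k s" m,
          OF borel_measurable_diff[OF meas[OF t] meas[OF s]] i z]
      by (simp add: e)
  qed
  show ?thesis
  proof (rule chaining_tendsto_zero[OF prob_space_axioms \<tau> residual_meas m2(1) residual_paths _ _ assms(2)])
    show "(LINT \<omega>|M. (residual m t \<omega> - residual m s \<omega>)\<^sup>2) \<le> K * (t - s)\<^sup>2"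
      if s: "s \<in> {0..\<tau>}" and t: "t \<in> {0..\<tau>}" for m s t
    proof -
      have "0 \<le> (\<Sum>k=1..m. lam k * (phi k t - phi k s)\<^sup>2)"
        by (intro sum_nonneg mult_nonneg_nonneg lam_nonneg) auto
      then show ?thesis using d2[OF s t, of m] K[OF s t] by linarith
    qed
    show "(\<lambda>m. LINT \<omega>|M. (residual m t \<omega>)\<^sup>2) \<longlonglongrightarrow> 0" if t: "t \<in> {0..\<tau>}" for t
    proof -
      have "(\<lambda>m. \<Sum>k=1..m. lam k * (phi k t)\<^sup>2) \<longlonglongrightarrow> c t t"
      proof (rule mercer_diagonal[OF \<tau> cont _ eig lam_nonneg _ _ t])
        show "c s t = c t s" for s t by (simp add: corr mult.commute)
        show "(\<Sum>k=1..m. lam k * (phi k t)\<^sup>2) \<le> c t t" if "t \<in> {0..\<tau>}" for m t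
          using m2(2)[OF that, of m] integral_nonneg_AE[where M = M and f = "\<lambda>\<omega>. (residual m t \<omega>)\<^sup>2"] by simp
        show "(\<Sum>k=1..m. lam k * (phi k t - phi k s)\<^sup>2) \<le> K * (t - s)\<^sup>2"
          if s: "s \<in> {0..\<tau>}" and t: "t \<in> {0..\<tau>}" for m s t
          using d2[OF s t, of m] K[OF s t]
            integral_nonneg_AE[where M = M and f = "\<lambda>\<omega>. (residual m t \<omega> - residual m s \<omega>)\<^sup>2"] by simp
      qed
      then show ?thesis
        unfolding m2(2)[OF t] by (auto intro: tendsto_eq_intros)
    qed
  qed
qed

end

subsection \<open>Convergence of the finite dimensional models\<close>

lemma infnorm_le_iff_cart: "infnorm (x :: real ^ 'n) \<le> e \<longleftrightarrow> (\<forall>i. \<bar>x $ i\<bar> \<le> e)"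
proof
  assume "\<forall>i. \<bar>x $ i\<bar> \<le> e"
  then show "infnorm x \<le> e"
    unfolding infnorm_cart by (intro cSup_least) auto
qed (use component_le_infnorm_cart order_trans in blast)

text \<open>The supremum runs over uncountably many times, but for continuous paths it is at most
  \<open>e\<close> exactly when the values at all dyadic points are, a countable intersection of
  events.\<close>

lemma borel_measurable_SUP_continuous_paths:
  fixes f :: "real \<Rightarrow> 'w \<Rightarrow> real"
  assumes \<tau>: "0 < \<tau>"
    and meas: "\<And>t. t \<in> {0..\<tau>} \<Longrightarrow> f t \<in> borel_measurable M"
    and paths: "\<And>\<omega>. \<omega> \<in> space M \<Longrightarrow> continuous_on {0..\<tau>} (\<lambda>t. f t \<omega>)"
  shows "(\<lambda>\<omega>. SUP t\<in>{0..\<tau>}. f t \<omega>) \<in> borel_measurable M"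
proof -
  let ?q = "dyadic_point \<tau>"
  have "{\<omega>\<in>space M. (SUP t\<in>{0..\<tau>}. f t \<omega>) \<le> e} \<in> sets M" for e
  proof -
    have "((SUP t\<in>{0..\<tau>}. f t \<omega>) \<le> e) \<longleftrightarrow> (\<forall>l. \<forall>j\<le>2 ^ l. f (?q l j) \<omega> \<le> e)"
      if \<omega>: "\<omega> \<in> space M" for \<omega>
    proof
      assume le: "(SUP t\<in>{0..\<tau>}. f t \<omega>) \<le> e"
      have bdd: "bdd_above ((\<lambda>t. f t \<omega>) ` {0..\<tau>})"
        by (intro bounded_imp_bdd_above compact_imp_bounded compact_continuous_image paths \<omega>) auto
      show "\<forall>l. \<forall>j\<le>2 ^ l. f (?q l j) \<omega> \<le> e"
      proof (intro allI impI)
        fix l j :: nat assume "j \<le> 2 ^ l"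
        then have "f (?q l j) \<omega> \<le> (SUP t\<in>{0..\<tau>}. f t \<omega>)"
          by (intro cSUP_upper bdd dyadic_point_mem \<tau>)
        with le show "f (?q l j) \<omega> \<le> e" by simp
      qed
    next
      assume "\<forall>l. \<forall>j\<le>2 ^ l. f (?q l j) \<omega> \<le> e"
      then have "f t \<omega> \<le> e" if "t \<in> {0..\<tau>}" for t
        by (intro le_of_le_dyadic[OF \<tau> paths[OF \<omega>] _ that, of 0]) blast
      then show "(SUP t\<in>{0..\<tau>}. f t \<omega>) \<le> e"
        using \<tau> by (intro cSUP_least) auto
    qed
    then have "{\<omega>\<in>space M. (SUP t\<in>{0..\<tau>}. f t \<omega>) \<le> e}
        = {\<omega>\<in>space M. \<forall>l. \<forall>j\<in>{..2 ^ l}. f (?q l j) \<omega> \<le> e}"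
      by auto
    also have "\<dots> \<in> sets M"
    proof (intro sets.sets_Collect_countable_All sets.sets_Collect_finite_All' )
      fix l j :: nat assume "j \<in> {..2 ^ l}"
      then have "f (?q l j) \<in> borel_measurable M"
        by (intro meas dyadic_point_mem \<tau>) simp
      then show "{\<omega>\<in>space M. f (?q l j) \<omega> \<le> e} \<in> sets M" by measurable
    qed auto
    finally show ?thesis .
  qed
  then show ?thesis by (simp add: borel_measurable_iff_le)
qed

theorem theorem3p2:
  fixes M :: "'w measure"
    and \<tau> :: real
    and X :: "real \<Rightarrow> 'w \<Rightarrow> real ^ 'n"
    and lam :: "'n \<Rightarrow> nat \<Rightarrow> real"
    and phi :: "'n \<Rightarrow> nat \<Rightarrow> real \<Rightarrow> real"
  assumes "prob_space M"
    and "0 < \<tau>"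
    and "continuous_zero_mean_process M \<tau> X"
    and "\<And>i. eigensystem \<tau> (correlation M X i i) (lam i) (phi i)"
    and "\<And>i. continuous_second_partials \<tau> (correlation M X i i)"
  shows "tendsto_in_probability M
           (\<lambda>d \<omega>. SUP t\<in>{0..\<tau>}. infnorm (fd_model \<tau> X phi d t \<omega> - X t \<omega>)) (\<lambda>_. 0)
           (filtercomap (\<lambda>d :: 'n \<Rightarrow> nat. MIN i. d i) at_top)"
proof -
  interpret prob_space M by fact
  let ?F = "filtercomap (\<lambda>d :: 'n \<Rightarrow> nat. MIN i. d i) at_top"
  have \<tau>: "0 < \<tau>" by fact
  have X_meas: "X t \<in> borel_measurable M" if "t \<in> {0..\<tau>}" for t
    using assms(3) that by (simp add: continuous_zero_mean_process_def)
  have X_paths: "continuous_on {0..\<tau>} (\<lambda>t. X t \<omega>)" if "\<omega> \<in> space M" for \<omega>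
    using assms(3) that by (simp add: continuous_zero_mean_process_def)
  interpret comp: eigen_process M \<tau> "\<lambda>t \<omega>. X t \<omega> $ i" "correlation M X i i" "lam i" "phi i" for i
  proof
    show "(\<lambda>\<omega>. X t \<omega> $ i) \<in> borel_measurable M" if "t \<in> {0..\<tau>}" for t
      by (intro measurable_compose[OF X_meas[OF that]] borel_measurable_continuous_onI continuous_intros)
    show "continuous_on {0..\<tau>} (\<lambda>t. X t \<omega> $ i)" if "\<omega> \<in> space M" for \<omega>
      by (intro continuous_intros X_paths that)
  qed (use assms in \<open>auto simp: continuous_zero_mean_process_def correlation_def\<close>)
  define R where "R d t \<omega> = fd_model \<tau> X phi d t \<omega> - X t \<omega>" for d t \<omega>
  have R_nth: "R d t \<omega> $ i = comp.residual i (d i) t \<omega>" for d t \<omega> i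
    by (simp add: R_def fd_model_def comp.residual_def comp.coeff_def fd_coeff_def comp.set_integral_eq_L)
  have R_meas: "(\<lambda>\<omega>. infnorm (R d t \<omega>)) \<in> borel_measurable M" if t: "t \<in> {0..\<tau>}" for d t
    unfolding borel_measurable_iff_le infnorm_le_iff_cart R_nth
  proof
    fix e
    have "{\<omega>\<in>space M. \<forall>i\<in>UNIV. \<bar>comp.residual i (d i) t \<omega>\<bar> \<le> e} \<in> sets M"
    proof (rule sets.sets_Collect_finite_All')
      show "{\<omega>\<in>space M. \<bar>comp.residual i (d i) t \<omega>\<bar> \<le> e} \<in> sets M" for i
        using comp.residual_meas[OF t, of i "d i"] by measurable
    qed auto
    then show "{\<omega>\<in>space M. \<forall>i. \<bar>comp.residual i (d i) t \<omega>\<bar> \<le> e} \<in> sets M" by simp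
  qed
  have R_paths: "continuous_on {0..\<tau>} (\<lambda>t. infnorm (R d t \<omega>))" if \<omega>: "\<omega> \<in> space M" for d \<omega>
  proof -
    have "continuous_on {0..\<tau>} (\<lambda>t. \<chi> i. comp.residual i (d i) t \<omega>)"
      by (intro continuous_on_vec_lambda comp.residual_paths \<omega>)
    moreover have "(\<chi> i. comp.residual i (d i) t \<omega>) = R d t \<omega>" for t
      by (simp add: vec_eq_iff R_nth)
    ultimately show ?thesis
      unfolding continuous_on_def by (auto intro: tendsto_infnorm)
  qed
  have S_iff: "e < (SUP t\<in>{0..\<tau>}. f t) \<longleftrightarrow> (\<exists>t\<in>{0..\<tau>}. e < f t)"
    if "continuous_on {0..\<tau>} f" for e and f :: "real \<Rightarrow> real"
    using \<tau> that
    by (intro less_cSUP_iff bounded_imp_bdd_above compact_imp_bounded compact_continuous_image) auto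
  have S_meas: "(\<lambda>\<omega>. SUP t\<in>{0..\<tau>}. infnorm (R d t \<omega>)) \<in> borel_measurable M" for d
    by (intro borel_measurable_SUP_continuous_paths \<tau> R_meas R_paths)
  \<comment> \<open>Each \<open>d i\<close> is at least the minimum, so it tends to infinity along
    this filter. The scalar limits therefore combine even if the \<open>d i\<close> grow at
    unrelated rates.\<close>
  have proj: "filterlim (\<lambda>d. d i) at_top ?F" for i
    unfolding filterlim_at_top
  proof
    fix N :: nat
    show "\<forall>\<^sub>F d in ?F. N \<le> d i"
      unfolding eventually_filtercomap_at_top_linorder
      by (rule exI[of _ N]) auto
  qed
  have "((\<lambda>d. measure M {\<omega>\<in>space M. \<epsilon> < \<bar>(SUP t\<in>{0..\<tau>}. infnorm (R d t \<omega>)) - 0\<bar>}) \<longlongrightarrow> 0) ?F"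
    if \<epsilon>: "0 < \<epsilon>" for \<epsilon>
  proof (rule tendsto_sandwich[OF always_eventually always_eventually tendsto_const])
    let ?E = "\<lambda>i m. {\<omega>\<in>space M. \<exists>t\<in>{0..\<tau>}. \<epsilon> < \<bar>comp.residual i m t \<omega>\<bar>}"
    show "((\<lambda>d. \<Sum>i\<in>UNIV. measure M (?E i (d i))) \<longlongrightarrow> 0) ?F"
      by (intro tendsto_null_sum filterlim_compose[OF comp.residual_tendsto_zero proj] assms \<epsilon>)
    \<comment> \<open>Union bound over the finitely many components: a large maximum norm at some
      time means that some component is large at that time.\<close>
    show "\<forall>d. measure M {\<omega>\<in>space M. \<epsilon> < \<bar>(SUP t\<in>{0..\<tau>}. infnorm (R d t \<omega>)) - 0\<bar>}
        \<le> (\<Sum>i\<in>UNIV. measure M (?E i (d i)))"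
    proof
      fix d
      have E_sets: "?E i m \<in> sets M" for i m
      proof -
        \<comment> \<open>An existential over uncountably many times becomes a superlevel set of a
          supremum, whose measurability is known.\<close>
        have "?E i m = {\<omega>\<in>space M. \<epsilon> < (SUP t\<in>{0..\<tau>}. \<bar>comp.residual i m t \<omega>\<bar>)}"
          by (intro Collect_cong conj_cong refl S_iff[symmetric] continuous_on_rabs comp.residual_paths)
        also have "\<dots> \<in> sets M"
          using borel_measurable_SUP_continuous_paths[OF \<tau> borel_measurable_abs[OF comp.residual_meas]
              continuous_on_rabs[OF comp.residual_paths]]
          by measurable
        finally show ?thesis .
      qed
      have sub: "{\<omega>\<in>space M. \<epsilon> < \<bar>(SUP t\<in>{0..\<tau>}. infnorm (R d t \<omega>)) - 0\<bar>} \<subseteq> (\<Union>i\<in>UNIV. ?E i (d i))"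
      proof
        fix \<omega> assume a: "\<omega> \<in> {\<omega>\<in>space M. \<epsilon> < \<bar>(SUP t\<in>{0..\<tau>}. infnorm (R d t \<omega>)) - 0\<bar>}"
        then have \<omega>: "\<omega> \<in> space M" by simp
        have "infnorm (R d 0 \<omega>) \<le> (SUP t\<in>{0..\<tau>}. infnorm (R d t \<omega>))"
          using \<tau>
          by (intro cSUP_upper bounded_imp_bdd_above compact_imp_bounded compact_continuous_image
              R_paths \<omega>) auto
        then have "0 \<le> (SUP t\<in>{0..\<tau>}. infnorm (R d t \<omega>))"
          using infnorm_pos_le[of "R d 0 \<omega>"] by linarith
        with a have "\<epsilon> < (SUP t\<in>{0..\<tau>}. infnorm (R d t \<omega>))" by simp
        then obtain t where t: "t \<in> {0..\<tau>}" "\<not> infnorm (R d t \<omega>) \<le> \<epsilon>"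
          using S_iff[OF R_paths[OF \<omega>]] by force
        then obtain i where "\<epsilon> < \<bar>comp.residual i (d i) t \<omega>\<bar>"
          unfolding infnorm_le_iff_cart R_nth by (meson not_le)
        then show "\<omega> \<in> (\<Union>i\<in>UNIV. ?E i (d i))" using t(1) \<omega> by blast
      qed
      have "measure M {\<omega>\<in>space M. \<epsilon> < \<bar>(SUP t\<in>{0..\<tau>}. infnorm (R d t \<omega>)) - 0\<bar>}
          \<le> measure M (\<Union>i\<in>UNIV. ?E i (d i))"
        by (intro finite_measure_mono sub sets.finite_UN finite E_sets)
      also have "\<dots> \<le> (\<Sum>i\<in>UNIV. measure M (?E i (d i)))"
        by (intro finite_measure_subadditive_finite finite) (auto simp only: E_sets)
      finally show "measure M {\<omega>\<in>space M. \<epsilon> < \<bar>(SUP t\<in>{0..\<tau>}. infnorm (R d t \<omega>)) - 0\<bar>}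
        \<le> (\<Sum>i\<in>UNIV. measure M (?E i (d i)))" .
    qed
  qed simp
  then show ?thesis
    using S_meas unfolding tendsto_in_probability_def R_def by auto
qed

end
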